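(* Let $n,m,d$ be positive integers with $n\ge d(m-1)+1$, and assume that $n$ players are $(m,d)$-hungry. Then there exist a partition of the $d$ cakes into $m$ interval pieces each, and an allocation of $d$-tuples of pieces to a subset $S$ of players with $|S|\ge\frac{m}{d-1}$ (distinct players in $S$ receiving $d$-tuples with no piece in common), such that each player in $S$ receives one of their favorite $d$-tuples of pieces in that partition.
   Context: There are $d$ cakes, each identified with a copy of $[0,1]$. A partition of the cakes into $m$ interval pieces each consists of, for each cake, cut points $0\le c_1\le\dots\le c_{m-1}\le 1$ giving $m$ (possibly empty) consecutive interval pieces. A $d$-tuple of pieces consists of one piece from each cake. For every such partition, each player chooses (prefers) some $d$-tuples of pieces. The $n$ players are called $(m,d)$-hungry if: (1) for any partition of the $d$ cakes into $m$ interval pieces each and any set $I$ of $n-d(m-1)$ players, some player in $I$ prefers a $d$-tuple consisting of non-empty pieces; and (2) preference sets are closed: if a player prefers a given $d$-tuple (indexed by positions of pieces) in each partition of a converging sequence of partitions, they prefer the same $d$-tuple in the limit partition. *)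

theory Defs
  imports "HOL-Analysis.Analysis"
begin

text \<open>Cakes are indexed by k < d, pieces by j < m. A partition is encoded by
  cut points c k j for j = 0..m, with c k 0 = 0, c k m = 1 and monotone;
  piece j of cake k is the interval [c k j, c k (j+1)]. Values outside
  the index range are fixed to 0 so that partitions have no junk.\<close>

definition partition_cuts :: "nat \<Rightarrow> nat \<Rightarrow> (nat \<Rightarrow> nat \<Rightarrow> real) \<Rightarrow> bool" where
  "partition_cuts d m c \<longleftrightarrow>
     (\<forall>k<d. c k 0 = 0 \<and> c k m = 1 \<and> (\<forall>j<m. c k j \<le> c k (Suc j))) \<and>
     (\<forall>k j. (d \<le> k \<or> m < j) \<longrightarrow> c k j = 0)"

text \<open>A d-tuple of pieces: entry k is the position of the chosen piece of cake k.\<close>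
definition dtuple :: "nat \<Rightarrow> nat \<Rightarrow> nat list \<Rightarrow> bool" where
  "dtuple d m t \<longleftrightarrow> length t = d \<and> (\<forall>x\<in>set t. x < m)"

definition nonempty_tuple :: "nat \<Rightarrow> (nat \<Rightarrow> nat \<Rightarrow> real) \<Rightarrow> nat list \<Rightarrow> bool" where
  "nonempty_tuple d c t \<longleftrightarrow> (\<forall>k<d. c k (t ! k) < c k (Suc (t ! k)))"

definition hungry ::
  "nat \<Rightarrow> nat \<Rightarrow> nat \<Rightarrow> (nat \<Rightarrow> (nat \<Rightarrow> nat \<Rightarrow> real) \<Rightarrow> nat list \<Rightarrow> bool) \<Rightarrow> bool" where
  "hungry n m d pref \<longleftrightarrow>
     (\<forall>c I. partition_cuts d m c \<and> I \<subseteq> {0..<n} \<and> card I = n - d * (m - 1) \<longrightarrow>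
        (\<exists>i\<in>I. \<exists>t. dtuple d m t \<and> nonempty_tuple d c t \<and> pref i c t)) \<and>
     (\<forall>i<n. \<forall>seq c t. (\<forall>l. partition_cuts d m (seq l)) \<and> partition_cuts d m c \<and>
        (\<forall>k j. (\<lambda>l. seq l k j) \<longlonglongrightarrow> c k j) \<and> dtuple d m t \<and>
        (\<forall>l. pref i (seq l) t) \<longrightarrow> pref i c t)"

end

theory Submission
  imports Defs
begin

text \<open>
  Every partition makes at least \<open>D + 1\<close> players happy, \<open>D = d (m - 1)\<close>, since otherwise \<open>n - D\<close>
  unhappy players would contradict hungriness. Triangulate the \<open>D\<close>-dimensional polytope of partitions
  finely and pass to the barycentric subdivision. The vertex belonging to a simplex \<open>\<sigma>\<close> with \<open>s\<close>
  vertices is given the \<open>(D + 1 - s)\<close>-th smallest player (counting from 0) among those happy at some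
  vertex of \<open>\<sigma>\<close>. These sets of players grow along a chain of simplices while the index drops, so the
  players along a chain are distinct. Sending each such vertex to a nonempty tuple preferred by its
  player gives a piecewise linear map of the polytope that respects faces, and by Brouwer's theorem
  it attains the barycentre \<open>1/m\<close> in every cake. The coefficients there form a fractional perfect
  matching of a \<open>d\<close>-partite hypergraph whose edges are tuples of distinct players, and
  Furedi's bound \<open>\<nu>\<^sup>* \<le> (d - 1) \<nu>\<close> yields \<open>m / (d - 1)\<close> disjoint ones. A limit over finer and
  finer triangulations turns approximate into exact preferences.
\<close>

subsection \<open>Matchings in multipartite hypergraphs\<close>

text \<open>Gaussian elimination, by induction on the set of equations: a nonzero coefficient
  \<open>a e i0\<close> solves equation \<open>e\<close> for the unknown \<open>i0\<close>, which
  leaves one equation and one unknown fewer.\<close>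

lemma nontrivial_homogeneous_solution:
  fixes a :: "'e \<Rightarrow> 'i \<Rightarrow> real"
  assumes "finite E" "finite A" "card E < card A"
  shows "\<exists>z. (\<exists>i\<in>A. z i \<noteq> 0) \<and> (\<forall>e\<in>E. (\<Sum>i\<in>A. a e i * z i) = 0)"
  using assms
proof (induction E arbitrary: A a rule: finite_induct)
  case empty
  then have "A \<noteq> {}" by auto
  then show ?case by (intro exI[of _ "\<lambda>_. 1"]) auto
next
  case (insert e E)
  show ?case
  proof (cases "\<forall>i\<in>A. a e i = 0")
    case True
    have "card E < card A" using insert by simp
    from insert.IH[OF insert.prems(1) this, of a] True show ?thesis by auto
  next
    case False
    then obtain i0 where i0: "i0 \<in> A" "a e i0 \<noteq> 0" by blast
    let ?A = "A - {i0}"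
    have "card E < card ?A" using insert i0 by simp
    from insert.IH[OF _ this, of "\<lambda>f i. a f i - a f i0 * a e i / a e i0"] insert.prems
    obtain z where z: "\<exists>i\<in>?A. z i \<noteq> 0"
      "\<And>f. f \<in> E \<Longrightarrow> (\<Sum>i\<in>?A. (a f i - a f i0 * a e i / a e i0) * z i) = 0" by auto
    define y where "y i = (if i = i0 then - (\<Sum>i\<in>?A. a e i * z i) / a e i0 else z i)" for i
    have split: "(\<Sum>i\<in>A. a f i * y i) = a f i0 * y i0 + (\<Sum>i\<in>?A. a f i * z i)" for f
      using i0(1) insert.prems(1) by (subst sum.remove[of A i0]) (auto simp: y_def)
    have "(\<Sum>i\<in>A. a f i * y i) = 0" if "f \<in> insert e E" for f
    proof (cases "f = e")
      case True
      then show ?thesis using split[of e] i0(2) by (simp add: y_def)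
    next
      case False
      then have "0 = (\<Sum>i\<in>?A. (a f i - a f i0 * a e i / a e i0) * z i)" using z(2) that by auto
      also have "\<dots> = (\<Sum>i\<in>?A. a f i * z i - a f i0 / a e i0 * (a e i * z i))"
        by (intro sum.cong) (auto simp: algebra_simps)
      also have "\<dots> = (\<Sum>i\<in>?A. a f i * z i) - a f i0 / a e i0 * (\<Sum>i\<in>?A. a e i * z i)"
        by (simp add: sum_subtractf sum_distrib_left)
      also have "\<dots> = (\<Sum>i\<in>A. a f i * y i)" unfolding split by (simp add: y_def)
      finally show ?thesis by simp
    qed
    moreover have "\<exists>i\<in>A. y i \<noteq> 0" using z(1) by (auto simp: y_def)
    ultimately show ?thesis by blast
  qed
qed

text \<open>The smallest ratio \<open>g c / - s c\<close> over the decreasing coordinates is the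
  time at which the ray from \<open>g\<close> in direction \<open>s\<close> reaches the boundary of
  the nonnegative orthant.\<close>

lemma first_exit_time:
  fixes g s :: "'c \<Rightarrow> real"
  assumes "finite C" "\<And>c. c \<in> C \<Longrightarrow> g c \<ge> 0" "\<exists>c\<in>C. s c < 0"
  obtains \<epsilon> c where "\<epsilon> \<ge> 0" "\<And>c. c \<in> C \<Longrightarrow> g c + \<epsilon> * s c \<ge> 0" "c \<in> C" "s c < 0" "g c + \<epsilon> * s c = 0"
proof -
  define R where "R = (\<lambda>c. g c / - s c) ` {c \<in> C. s c < 0}"
  have R: "finite R" "R \<noteq> {}" using assms by (auto simp: R_def)
  have "Min R \<in> R" using R by simp
  then obtain c where c: "c \<in> C" "s c < 0" "Min R = g c / - s c" unfolding R_def by auto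
  show ?thesis
  proof (rule that[of "Min R" c])
    show ge: "Min R \<ge> 0" using c assms(2)[OF c(1)] by (simp add: divide_nonneg_neg)
    show "g b + Min R * s b \<ge> 0" if b: "b \<in> C" for b
    proof (cases "s b < 0")
      case True
      then have "Min R \<le> g b / - s b" using R b by (intro Min_le) (auto simp: R_def)
      moreover have "0 < - s b" using True by simp
      ultimately have "Min R * - s b \<le> g b" by (simp only: pos_le_divide_eq)
      then show ?thesis by simp
    next
      case False then show ?thesis using ge assms(2)[OF b] by (simp add: )
    qed
  qed (use c in auto)
qed

text \<open>The edge \<open>i\<close> of the hypergraph consists of the vertices \<open>(k, e i k)\<close>, \<open>k < d\<close>.\<close>

definition load :: "('i \<Rightarrow> nat \<Rightarrow> 'v) \<Rightarrow> 'i set \<Rightarrow> ('i \<Rightarrow> real) \<Rightarrow> nat \<times> 'v \<Rightarrow> real" where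
  "load e J w x = (\<Sum>i | i \<in> J \<and> e i (fst x) = snd x. w i)"

definition fractional_matching :: "nat \<Rightarrow> ('i \<Rightarrow> nat \<Rightarrow> 'v) \<Rightarrow> 'i set \<Rightarrow> ('i \<Rightarrow> real) \<Rightarrow> bool" where
  "fractional_matching d e J w \<longleftrightarrow> (\<forall>i\<in>J. 0 \<le> w i) \<and> (\<forall>k<d. \<forall>v. load e J w (k, v) \<le> 1)"

lemma load_alt: "finite J \<Longrightarrow> load e J w x = (\<Sum>i\<in>J. (if e i (fst x) = snd x then 1 else 0) * w i)"
  unfolding load_def by (simp add: sum.inter_filter if_distrib[of "\<lambda>c. c * _"] cong: if_cong)

lemma load_add_scale:
  "finite J \<Longrightarrow> load e J (\<lambda>i. w i + \<epsilon> * z i) x = load e J w x + \<epsilon> * load e J z x"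
  unfolding load_def by (simp add: sum.distrib sum_distrib_left)

lemma load_mono:
  assumes "finite J" "J' \<subseteq> J" "\<And>i. i \<in> J \<Longrightarrow> 0 \<le> w i"
  shows "load e J' w x \<le> load e J w x"
  unfolding load_def using assms by (intro sum_mono2) auto

text \<open>Each edge has exactly one vertex on side \<open>k\<close>, so the result does not depend
  on \<open>k\<close>. This makes the saturation equations of two sides dependent.\<close>

lemma sum_load:
  assumes "finite J" "finite V" "\<And>i. i \<in> J \<Longrightarrow> e i k \<in> V"
  shows "(\<Sum>v\<in>V. load e J w (k, v)) = (\<Sum>i\<in>J. w i)"
proof -
  have "(\<Sum>v\<in>V. load e J w (k, v)) = (\<Sum>v\<in>V. \<Sum>i | i \<in> J \<and> e i k = v. w i)"
    by (simp add: load_def)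
  also have "\<dots> = (\<Sum>i\<in>J. w i)" using assms by (intro sum.group) auto
  finally show ?thesis .
qed

lemma fractional_matching_mono:
  assumes "fractional_matching d e J w" "finite J" "J' \<subseteq> J"
  shows "fractional_matching d e J' w"
  using assms load_mono[OF assms(2,3), of w e] unfolding fractional_matching_def
  by (meson order_trans subsetD)

lemma sum_UN_lessThan_le:
  fixes w :: "'i \<Rightarrow> real" and n :: nat
  assumes "\<And>k. k < n \<Longrightarrow> finite (A k)" "\<And>k i. k < n \<Longrightarrow> i \<in> A k \<Longrightarrow> 0 \<le> w i"
  shows "sum w (\<Union>k<n. A k) \<le> (\<Sum>k<n. sum w (A k))"
  using assms
proof (induction n)
  case 0
  then show ?case by simp
next
  case (Suc n)
  have "sum w (\<Union>k<Suc n. A k) = sum w (A n) + sum w (\<Union>k<n. A k) - sum w (A n \<inter> (\<Union>k<n. A k))"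
    unfolding lessThan_Suc UN_insert using Suc.prems by (intro sum_Un) auto
  moreover have "0 \<le> sum w (A n \<inter> (\<Union>k<n. A k))" using Suc.prems by (intro sum_nonneg) auto
  moreover have "sum w (\<Union>k<n. A k) \<le> (\<Sum>k<n. sum w (A k))"
    by (rule Suc.IH) (use Suc.prems in \<open>auto intro: less_SucI\<close>)
  ultimately show ?case by simp
qed

text \<open>The load at each of the \<open>d\<close> vertices of \<open>i0\<close> is at most 1 and
  contains \<open>w i0\<close>, which leaves at most \<open>1 - w i0\<close> for the other edges
  there; \<open>i0\<close> itself is then added once.\<close>

lemma sum_neighbours_le:
  assumes fm: "fractional_matching d e J w" and J: "finite J" and i0: "i0 \<in> J" and "0 < d"
  shows "(\<Sum>i | i \<in> J \<and> (\<exists>k<d. e i k = e i0 k). w i) \<le> d - (d - 1) * w i0"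
proof -
  let ?N = "{i \<in> J. i \<noteq> i0 \<and> (\<exists>k<d. e i k = e i0 k)}"
  let ?Nk = "\<lambda>k. {i \<in> J. i \<noteq> i0 \<and> e i k = e i0 k}"
  have w: "\<And>i. i \<in> J \<Longrightarrow> 0 \<le> w i" using fm by (auto simp: fractional_matching_def)
  have "(\<Sum>i | i \<in> J \<and> (\<exists>k<d. e i k = e i0 k). w i) = (\<Sum>i\<in>insert i0 ?N. w i)"
    using i0 \<open>0 < d\<close> by (intro sum.cong) auto
  also have "\<dots> = w i0 + sum w ?N" using J by (subst sum.insert) auto
  also have "?N = (\<Union>k<d. ?Nk k)" by auto
  also have "sum w (\<Union>k<d. ?Nk k) \<le> (\<Sum>k<d. sum w (?Nk k))"
    using J w by (intro sum_UN_lessThan_le) auto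
  also have "(\<Sum>k<d. sum w (?Nk k)) \<le> (\<Sum>k<d. 1 - w i0)"
  proof (rule sum_mono)
    fix k assume "k \<in> {..<d}"
    then have "load e J w (k, e i0 k) \<le> 1" using fm by (auto simp: fractional_matching_def)
    moreover have "{i \<in> J. e i k = e i0 k} = insert i0 (?Nk k)" using i0 by auto
    then have "load e J w (k, e i0 k) = w i0 + sum w (?Nk k)"
      unfolding load_def using J by simp
    ultimately show "sum w (?Nk k) \<le> 1 - w i0" by linarith
  qed
  finally show ?thesis using \<open>0 < d\<close> by (simp add: algebra_simps of_nat_diff)
qed


text \<open>
  Furedi's bound. Among the fractional matchings of at least the given size take one with the most
  saturated vertices. If a saturated vertex has degree at most \<open>d - 1\<close>, one of its edges has weight
  at least \<open>1/(d - 1)\<close>; selecting that edge and dropping its neighbours loses weight at most \<open>d - 1\<close>.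
  Otherwise double counting gives at least as many edges as saturated vertices, so the weights can be
  perturbed until an edge gets weight 0 or a further vertex is saturated. In the case of equality
  every edge consists of saturated vertices, and one saturation equation is redundant because the
  loads of two sides have the same sum.
\<close>

lemma matching_of_fractional_matching:
  assumes "finite J" "2 \<le> d" "fractional_matching d e J w"
  shows "\<exists>S\<subseteq>J. sum w J \<le> real (d - 1) * card S \<and>
           (\<forall>i\<in>S. \<forall>j\<in>S. i \<noteq> j \<longrightarrow> (\<forall>k<d. e i k \<noteq> e j k))"
  using assms(1,3)
proof (induction J arbitrary: w rule: finite_psubset_induct)
  case (psubset J)
  note J = psubset.hyps and fm = psubset.prems
  define X where "X = (SIGMA k:{..<d}. (\<lambda>i. e i k) ` J)"
  have X: "finite X" unfolding X_def using J by auto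
  define F where "F w' \<longleftrightarrow> fractional_matching d e J w' \<and> sum w J \<le> sum w' J" for w'
  \<comment> \<open>An edge of weight 0 in some competitor can be deleted, which settles that case
    by induction; in the last case reaching weight 0 is a contradiction.\<close>
  consider (empty) "J = {}" | (zero) w' i where "F w'" "i \<in> J" "w' i = 0"
    | (pos) "J \<noteq> {}" "\<And>w' i. F w' \<Longrightarrow> i \<in> J \<Longrightarrow> w' i \<noteq> 0" by blast
  then show ?case
  proof cases
    case empty then show ?thesis by auto
  next
    case zero
    have "J - {i} \<subset> J" using zero by auto
    moreover have "fractional_matching d e (J - {i}) w'"
      using zero J by (auto simp: F_def intro: fractional_matching_mono)
    ultimately obtain S where S: "S \<subseteq> J - {i}" "sum w' (J - {i}) \<le> real (d - 1) * card S"
      "\<forall>i\<in>S. \<forall>j\<in>S. i \<noteq> j \<longrightarrow> (\<forall>k<d. e i k \<noteq> e j k)" using psubset.IH by meson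
    have "sum w' J = sum w' (J - {i})" using zero J by (simp add: sum.remove)
    then show ?thesis using S zero by (intro exI[of _ S]) (auto simp: F_def)
  next
    case pos
    \<comment> \<open>Saturated vertices are maximised by minimising the number of unsaturated ones,
      a natural number, so that a minimiser exists without a compactness argument.\<close>
    define nt where "nt w' = card {x \<in> X. load e J w' x < 1}" for w'
    have "F w" using fm by (simp add: F_def)
    then obtain u where u: "F u" and least: "\<And>w'. F w' \<Longrightarrow> nt u \<le> nt w'"
      using ex_has_least_nat[of F w nt] by blast
    have ufm: "fractional_matching d e J u" and usum: "sum w J \<le> sum u J" using u by (auto simp: F_def)
    have upos: "0 < u i" if "i \<in> J" for i
      using pos(2)[OF u that] ufm that by (fastforce simp: fractional_matching_def)
    define T where "T = {x \<in> X. load e J u x = 1}"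
    have T: "finite T" "T \<subseteq> X" using X by (auto simp: T_def)
    define deg where "deg x = card {i \<in> J. e i (fst x) = snd x}" for x
    show ?thesis
    proof (cases "\<exists>x\<in>T. deg x \<le> d - 1")
      case True
      then obtain x where x: "x \<in> T" "deg x \<le> d - 1" by blast
      let ?A = "{i \<in> J. e i (fst x) = snd x}"
      have sum1: "sum u ?A = 1" using x by (simp add: T_def load_def)
      then have ne: "?A \<noteq> {}" by force
      have "\<exists>i0\<in>?A. 1 \<le> real (d - 1) * u i0"
      proof (rule ccontr)
        assume "\<not> ?thesis"
        then have "real (d - 1) * u i < 1" if "i \<in> ?A" for i using that by force
        then have "(\<Sum>i\<in>?A. real (d - 1) * u i) < (\<Sum>i\<in>?A. 1)"
          using ne J by (intro sum_strict_mono) auto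
        then have "real (d - 1) < card ?A" using sum1 by (simp flip: sum_distrib_left)
        then show False using x by (simp add: deg_def)
      qed
      then obtain i0 where i0: "i0 \<in> J" "1 \<le> real (d - 1) * u i0" by blast
      let ?J = "{i \<in> J. \<forall>k<d. e i k \<noteq> e i0 k}"
      let ?N = "{i \<in> J. \<exists>k<d. e i k = e i0 k}"
      have "i0 \<notin> ?J" using assms(2) by (auto intro!: exI[of _ 0])
      then have "?J \<subset> J" using i0 by blast
      moreover from this have "fractional_matching d e ?J u" using ufm J by (auto intro: fractional_matching_mono)
      ultimately obtain S where S: "S \<subseteq> ?J" "sum u ?J \<le> real (d - 1) * card S"
        "\<forall>i\<in>S. \<forall>j\<in>S. i \<noteq> j \<longrightarrow> (\<forall>k<d. e i k \<noteq> e j k)" using psubset.IH by meson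
      have "sum u ?N \<le> d - real (d - 1) * u i0"
        using sum_neighbours_le[OF ufm J i0(1)] assms(2) by (simp add: of_nat_diff)
      also have "\<dots> \<le> real (d - 1)" using i0 assms(2) by (simp add: of_nat_diff)
      finally have N: "sum u ?N \<le> real (d - 1)" .
      have "sum u J = sum u (?J \<union> ?N)" by (rule arg_cong[of _ _ "sum u"]) auto
      also have "\<dots> = sum u ?J + sum u ?N" using J by (intro sum.union_disjoint) auto
      also have "\<dots> \<le> real (d - 1) * (card S + 1)" using S N by (simp add: algebra_simps)
      also have "card S + 1 = card (insert i0 S)"
        using S J i0 assms(2) finite_subset[OF S(1)] by (subst card_insert_disjoint) force+
      finally show ?thesis using S i0 usum
        by (intro exI[of _ "insert i0 S"]) (fastforce)
    next
      case False
      then have deg: "d \<le> deg x" if "x \<in> T" for x using that assms(2) by force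
      define r where "r i = card {k. k < d \<and> (k, e i k) \<in> T}" for i
      have r_le: "r i \<le> d" for i unfolding r_def
        by (rule order_trans[OF card_mono[of "{..<d}"]]) auto
      have "d * card T \<le> (\<Sum>x\<in>T. deg x)" using sum_mono[of T "\<lambda>_. d" deg] deg by (simp add: mult.commute)
      also have "\<dots> = (\<Sum>i\<in>J. card {x \<in> T. e i (fst x) = snd x})"
        unfolding deg_def by (rule sum_multicount_gen[symmetric]) (use T J in auto)
      also have "\<dots> = (\<Sum>i\<in>J. r i)"
      proof (intro sum.cong refl)
        fix i
        have "{x \<in> T. e i (fst x) = snd x} = (\<lambda>k. (k, e i k)) ` {k. k < d \<and> (k, e i k) \<in> T}"
          using T(2) by (auto simp: X_def)
        then show "card {x \<in> T. e i (fst x) = snd x} = r i"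
          unfolding r_def by (simp add: card_image inj_on_def)
      qed
      finally have le: "d * card T \<le> (\<Sum>i\<in>J. r i)" .
      have le': "(\<Sum>i\<in>J. r i) \<le> d * card J" using sum_mono[of J r "\<lambda>_. d"] r_le by (simp add: mult.commute)
      have TJ: "card T \<le> card J" using le le' assms(2) by (metis order_trans mult_le_cancel1 not_numeral_le_zero gr0I)
      have "\<exists>z. (\<exists>i\<in>J. z i \<noteq> 0) \<and> (\<forall>x\<in>T. load e J z x = 0)"
      proof (cases "card T < card J")
        case True
        from nontrivial_homogeneous_solution[OF T(1) J this] show ?thesis
          by (simp add: load_alt[OF J])
      next
        case False
        then have "(\<Sum>i\<in>J. r i) = (\<Sum>i\<in>J. d)" using TJ le le' by (simp add: mult.commute)
        then have "r i = d" if "i \<in> J" for i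
          using sum_mono_inv[of r J "\<lambda>_. d" i] that r_le J by auto
        then have inT: "(k, e i k) \<in> T" if "i \<in> J" "k < d" for i k
          using that card_subset_eq[of "{..<d}" "{k. k < d \<and> (k, e i k) \<in> T}"] unfolding r_def by auto
        obtain i1 where i1: "i1 \<in> J" using pos by blast
        let ?x = "(0, e i1 0)"
        have x: "?x \<in> T" using inT i1 assms(2) by auto
        have "card (T - {?x}) < card J" using x T TJ by (metis card_Diff1_less order_less_le_trans)
        from nontrivial_homogeneous_solution[OF _ J this, of "\<lambda>x i. if e i (fst x) = snd x then 1 else 0"] T(1)
        obtain z where z: "\<exists>i\<in>J. z i \<noteq> 0" "\<And>x. x \<in> T - {?x} \<Longrightarrow> load e J z x = 0"
          unfolding load_alt[OF J] by blast
        let ?V = "\<lambda>k. (\<lambda>i. e i k) ` J"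
        \<comment> \<open>The dropped equation at \<open>?x\<close> follows from the others: the
          remaining loads on side 0 vanish, the two sides have equal sums, and all loads on side 1
          vanish. Side 1 exists because \<open>2 \<le> d\<close>.\<close>
        have "load e J z ?x = (\<Sum>v\<in>?V 0. load e J z (0, v))"
        proof (subst sum.remove[of _ "e i1 0"])
          have "load e J z (0, v) = 0" if "v \<in> ?V 0 - {e i1 0}" for v
            using that inT assms(2) by (intro z(2)) auto
          then show "load e J z ?x = load e J z ?x + (\<Sum>v\<in>?V 0 - {e i1 0}. load e J z (0, v))" by simp
        qed (use i1 J in auto)
        also have "\<dots> = (\<Sum>v\<in>?V 1. load e J z (1, v))" using J by (simp add: sum_load)
        also have "\<dots> = 0" using z(2) inT assms(2) by (intro sum.neutral) auto
        finally show ?thesis using z by (metis Diff_iff empty_iff insert_iff)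
      qed
      then obtain z0 where z0: "\<exists>i\<in>J. z0 i \<noteq> 0" "\<forall>x\<in>T. load e J z0 x = 0" by blast
      \<comment> \<open>The sign is chosen so that moving along \<open>z\<close> does not lower the
        total weight.\<close>
      define z where "z = (if 0 \<le> sum z0 J then z0 else (\<lambda>i. - z0 i))"
      have z: "\<exists>i\<in>J. z i \<noteq> 0" "\<And>x. x \<in> T \<Longrightarrow> load e J z x = 0" "0 \<le> sum z J"
        using z0 by (auto simp: z_def load_def sum_negf)
      define Y where "Y = {x \<in> X. load e J u x < 1}"
      \<comment> \<open>The constraints are the edge weights (\<open>Inl\<close>) and the
        unsaturated vertices (\<open>Inr\<close>); \<open>g\<close> is the current slack and
        \<open>s\<close> its rate of change along \<open>z\<close>. The load of a saturated vertex
        stays constant along \<open>z\<close>.\<close>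
      define C where "C = Inl ` J \<union> Inr ` Y"
      define g where "g = case_sum u (\<lambda>x. 1 - load e J u x)"
      define s where "s = case_sum z (\<lambda>x. - load e J z x)"
      have "finite C" using J X by (auto simp: C_def Y_def)
      moreover have "g c \<ge> 0" if "c \<in> C" for c using that upos by (force simp: C_def g_def Y_def)
      moreover have "\<exists>c\<in>C. s c < 0"
      proof (cases "\<exists>i\<in>J. z i < 0")
        case True
        then obtain i where "i \<in> J" "z i < 0" by blast
        then show ?thesis by (intro bexI[of _ "Inl i"]) (auto simp: C_def s_def)
      next
        case False
        \<comment> \<open>With \<open>z\<close> nonnegative and nonzero, the load of some vertex
          grows; that vertex is not saturated, since the load of \<open>z\<close> vanishes on
          \<open>T\<close>.\<close>
        then obtain i where i: "i \<in> J" "z i > 0" using z(1) by force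
        have "z i \<le> load e J z (0, e i 0)" unfolding load_def using i False J
          by (intro member_le_sum) auto
        then have pos: "load e J z (0, e i 0) > 0" using i by simp
        have xX: "(0, e i 0) \<in> X" using i assms(2) by (auto simp: X_def)
        then have "load e J u (0, e i 0) \<le> 1" using ufm assms(2) by (simp add: fractional_matching_def)
        moreover have "load e J u (0, e i 0) \<noteq> 1" using pos z(2)[of "(0, e i 0)"] xX by (auto simp: T_def)
        ultimately have "Inr (0, e i 0) \<in> C" using xX by (auto simp: C_def Y_def)
        then show ?thesis using pos by (intro bexI[of _ "Inr (0, e i 0)"]) (auto simp: s_def)
      qed
      ultimately obtain \<epsilon> c where c: "\<epsilon> \<ge> 0" "\<And>c. c \<in> C \<Longrightarrow> g c + \<epsilon> * s c \<ge> 0" "c \<in> C" "s c < 0"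
        "g c + \<epsilon> * s c = 0" using first_exit_time[of C g s] by blast
      define w' where "w' i = u i + \<epsilon> * z i" for i
      have lw': "load e J w' x = load e J u x + \<epsilon> * load e J z x" for x
        unfolding w'_def using J by (rule load_add_scale)
      have "0 \<le> w' i" if "i \<in> J" for i using c(2)[of "Inl i"] that by (auto simp: C_def g_def s_def w'_def)
      moreover have "load e J w' (k, v) \<le> 1" if "k < d" for k v
      proof -
        have "load e J u (k, v) \<le> 1" using ufm that by (simp add: fractional_matching_def)
        then consider "(k, v) \<in> T" | "(k, v) \<in> Y" | "(k, v) \<notin> X"
          unfolding T_def Y_def by fastforce
        then show ?thesis
        proof cases
          case 1 then show ?thesis by (simp add: lw' z(2) T_def)
        next
          case 2 then show ?thesis using c(2)[of "Inr (k, v)"] by (auto simp: C_def g_def s_def lw')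
        next
          case 3
          then have "{i \<in> J. e i k = v} = {}" using that by (auto simp: X_def)
          then show ?thesis by (simp only: load_def fst_conv snd_conv) simp
        qed
      qed
      moreover have "sum w' J = sum u J + \<epsilon> * sum z J" by (simp add: w'_def sum.distrib sum_distrib_left)
      then have "sum w J \<le> sum w' J" using usum c(1) z(3) by (simp add: add_increasing2)
      ultimately have Fw': "F w'" by (auto simp: F_def fractional_matching_def)
      show ?thesis
      \<comment> \<open>The slack that vanishes is either an edge weight, excluded in the present
        case, or that of a newly saturated vertex, against the choice of \<open>u\<close>.\<close>
      proof (cases c)
        case (Inl i)
        then have "i \<in> J" "w' i = 0" using c(3,5) by (auto simp: C_def g_def s_def w'_def)
        then show ?thesis using pos(2)[OF Fw'] by blast
      next
        case (Inr x)
        then have x: "x \<in> Y" "load e J w' x = 1" using c(3,5) by (auto simp: C_def g_def s_def lw')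
        have "{x \<in> X. load e J w' x < 1} \<subseteq> Y - {x}"
        proof
          fix y assume "y \<in> {x \<in> X. load e J w' x < 1}"
          then have y: "y \<in> X" "load e J w' y < 1" by auto
          have "load e J u y \<le> 1" using y(1) ufm by (auto simp: X_def fractional_matching_def)
          moreover have "y \<notin> T" using y(2) z(2)[of y] lw'[of y] by (auto simp: T_def)
          ultimately have "y \<in> Y" using y(1) by (simp add: T_def Y_def)
          then show "y \<in> Y - {x}" using x(2) y(2) by auto
        qed
        then have "nt w' < card Y" unfolding nt_def using x X
          by (intro psubset_card_mono) (auto simp: Y_def)
        then show ?thesis using least[OF Fw'] by (simp add: nt_def Y_def)
      qed
    qed
  qed
qed

subsection \<open>Brouwer's theorem in a finite number of coordinates\<close>

text \<open>A cube in a function space instead of a Euclidean space, so that coordinates can be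
  indexed by pairs of naturals and the dimension can depend on variables.\<close>

definition box01 :: "('a \<Rightarrow> real) set" where
  "box01 = {x. \<forall>a. 0 \<le> x a \<and> x a \<le> 1}"

lemma compact_box01: "compact (box01 :: ('a \<Rightarrow> real) set)"
proof -
  have "compactin (product_topology (\<lambda>_::'a. euclidean :: real topology) UNIV) (PiE UNIV (\<lambda>_. {0..1}))"
    by (simp add: compactin_PiE)
  moreover have "PiE UNIV (\<lambda>_. {0..1}) = (box01 :: ('a \<Rightarrow> real) set)"
    by (auto simp: box01_def PiE_def Pi_def)
  ultimately show ?thesis by (simp add: euclidean_product_topology)
qed

lemma tendsto_coordinate:
  fixes X :: "nat \<Rightarrow> 'a::countable \<Rightarrow> real"
  assumes "X \<longlonglongrightarrow> x" shows "(\<lambda>l. X l a) \<longlonglongrightarrow> x a"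
proof -
  have "continuous_on UNIV (\<lambda>y :: 'a \<Rightarrow> real. y a)" by simp
  then have "isCont (\<lambda>y :: 'a \<Rightarrow> real. y a) x"
    using continuous_on_eq_continuous_at[of UNIV] by blast
  from isCont_tendsto_compose[OF this assms] show ?thesis .
qed

lemma tendsto_coordinatewise:
  fixes X :: "nat \<Rightarrow> 'a::countable \<Rightarrow> real"
  assumes "\<And>a. (\<lambda>l. X l a) \<longlonglongrightarrow> x a" shows "X \<longlonglongrightarrow> x"
  using assms limitin_componentwise[of "\<lambda>_. euclidean :: real topology" UNIV X x sequentially]
  by (simp add: euclidean_product_topology)

lemma box01_sequence:
  fixes X :: "nat \<Rightarrow> 'a::countable \<Rightarrow> real"
  assumes "\<And>l. X l \<in> box01"
  obtains x r where "x \<in> box01" "strict_mono r" "(X \<circ> r) \<longlonglongrightarrow> x"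
  using compact_box01[where 'a='a] assms unfolding compact_eq_seq_compact_metric seq_compact_def
  by metis

text \<open>Kuhn's combinatorial lemma on the grid of mesh \<open>1 / p\<close> yields a cell in
  which, for each coordinate, \<open>f\<close> does not lower it at one corner and does not raise it
  at another. As \<open>p\<close> grows, the cells shrink along a subsequence to a point where both
  inequalities hold.\<close>

lemma brouwer_box01:
  fixes f :: "('a::countable \<Rightarrow> real) \<Rightarrow> 'a \<Rightarrow> real"
  assumes "finite A"
    and cont: "\<And>a. a \<in> A \<Longrightarrow> continuous_on box01 (\<lambda>x. f x a)"
    and into: "\<And>x a. x \<in> box01 \<Longrightarrow> a \<in> A \<Longrightarrow> f x a \<in> {0..1}"
  shows "\<exists>x\<in>box01. \<forall>a\<in>A. f x a = x a"
proof -
  obtain h where h: "bij_betw h {..<card A} A"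
    using ex_bij_betw_nat_finite[OF \<open>finite A\<close>] by (auto simp: atLeast0LessThan)
  define n where "n = card A"
  define h' where "h' = the_inv_into {..<n} h"
  have h': "h' a < n" "h (h' a) = a" if "a \<in> A" for a
    using that h unfolding h'_def n_def
    by (auto simp: bij_betw_def f_the_inv_into_f dest: the_inv_into_into[of h _ a "{..<card A}"])
  have hA: "h i \<in> A" "h' (h i) = i" if "i < n" for i
    using that h unfolding h'_def n_def by (auto simp: bij_betw_def the_inv_into_f_f)
  \<comment> \<open>The point with integer grid coordinates \<open>q\<close>; coordinates outside
    \<open>A\<close> are frozen at 0.\<close>
  define pt where "pt p q a = (if a \<in> A then real (q (h' a)) / real p else 0)" for p and q :: "nat \<Rightarrow> nat" and a
  have pt: "pt p q \<in> box01" if "\<forall>i<n. q i \<le> p" for p q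
    using that h' by (auto simp: pt_def box01_def divide_le_eq_1)
  \<comment> \<open>Label 1 means that \<open>f\<close> does not raise coordinate \<open>i\<close>.
    Kuhn's lemma prescribes the label on the faces \<open>q i = 0\<close> and
    \<open>q i = p\<close>; the prescribed labels keep this meaning since \<open>f\<close> takes
    values in \<open>[0,1]\<close>.\<close>
  define lab where "lab p q i = (if q i = p \<or> (q i \<noteq> 0 \<and> f (pt p q) (h i) \<le> pt p q (h i)) then 1 else 0 :: nat)"
    for p q i
  have lab0: "pt p q (h i) \<le> f (pt p q) (h i)" if "lab p q i = 0" "i < n" "\<forall>i<n. q i \<le> p" for p q i
    using that into[OF pt[OF that(3)] hA(1)[OF that(2)]] hA[OF that(2)]
    by (auto simp: lab_def pt_def split: if_splits)
  have lab1: "f (pt p q) (h i) \<le> pt p q (h i)" if "lab p q i \<noteq> 0" "i < n" "\<forall>i<n. q i \<le> p" "0 < p" for p q i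
    using that into[OF pt[OF that(3)] hA(1)[OF that(2)]] hA[OF that(2)]
    by (auto simp: lab_def pt_def split: if_splits)
  have "\<exists>q. (\<forall>i<n. q i < p) \<and> (\<forall>i<n. \<exists>r s. (\<forall>j<n. q j \<le> r j \<and> r j \<le> q j + 1) \<and>
      (\<forall>j<n. q j \<le> s j \<and> s j \<le> q j + 1) \<and> lab p r i \<noteq> lab p s i)" if "0 < p" for p
  proof -
    have "\<forall>x. (\<forall>i<n. x i \<le> p) \<longrightarrow> (\<forall>i<n. lab p x i = 0 \<or> lab p x i = 1)"
      "\<forall>x. (\<forall>i<n. x i \<le> p) \<longrightarrow> (\<forall>i<n. x i = 0 \<longrightarrow> lab p x i = 0)"
      "\<forall>x. (\<forall>i<n. x i \<le> p) \<longrightarrow> (\<forall>i<n. x i = p \<longrightarrow> lab p x i = 1)"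
      using that by (auto simp: lab_def)
    from kuhn_lemma[OF that this] show ?thesis by metis
  qed
  then obtain Q where "\<forall>p>0. (\<forall>i<n. Q p i < p) \<and> (\<forall>i<n. \<exists>r s. (\<forall>j<n. Q p j \<le> r j \<and> r j \<le> Q p j + 1) \<and>
      (\<forall>j<n. Q p j \<le> s j \<and> s j \<le> Q p j + 1) \<and> lab p r i \<noteq> lab p s i)" by metis
  then have Q: "\<And>p i. 0 < p \<Longrightarrow> i < n \<Longrightarrow> Q p i < p"
    "\<And>p i. 0 < p \<Longrightarrow> i < n \<Longrightarrow> \<exists>r s. (\<forall>j<n. Q p j \<le> r j \<and> r j \<le> Q p j + 1) \<and>
      (\<forall>j<n. Q p j \<le> s j \<and> s j \<le> Q p j + 1) \<and> lab p r i \<noteq> lab p s i" by blast+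
  have "\<exists>r s. (\<forall>j<n. Q p j \<le> r j \<and> r j \<le> Q p j + 1) \<and> (\<forall>j<n. Q p j \<le> s j \<and> s j \<le> Q p j + 1) \<and>
      lab p r i = 0 \<and> lab p s i \<noteq> 0" if "0 < p" "i < n" for p i
    using Q(2)[OF that] by (metis lab_def)
  then obtain R S where "\<forall>p>0. \<forall>i<n. (\<forall>j<n. Q p j \<le> R p i j \<and> R p i j \<le> Q p j + 1) \<and>
      (\<forall>j<n. Q p j \<le> S p i j \<and> S p i j \<le> Q p j + 1) \<and> lab p (R p i) i = 0 \<and> lab p (S p i) i \<noteq> 0" by metis
  then have RS: "\<And>p i j. 0 < p \<Longrightarrow> i < n \<Longrightarrow> j < n \<Longrightarrow> Q p j \<le> R p i j \<and> R p i j \<le> Q p j + 1"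
    "\<And>p i j. 0 < p \<Longrightarrow> i < n \<Longrightarrow> j < n \<Longrightarrow> Q p j \<le> S p i j \<and> S p i j \<le> Q p j + 1"
    "\<And>p i. 0 < p \<Longrightarrow> i < n \<Longrightarrow> lab p (R p i) i = 0"
    "\<And>p i. 0 < p \<Longrightarrow> i < n \<Longrightarrow> lab p (S p i) i \<noteq> 0" by blast+
  have le: "R p i j \<le> p" "S p i j \<le> p" "Q p j \<le> p" if "0 < p" "i < n" "j < n" for p i j
    using RS(1,2)[OF that] Q(1)[OF that(1,3)] by auto
  define X where "X l = pt (Suc l) (Q (Suc l))" for l
  have "X l \<in> box01" for l unfolding X_def using le by (intro pt) auto
  from box01_sequence[of X, OF this] obtain x r where x: "x \<in> box01" "strict_mono r" "(X \<circ> r) \<longlonglongrightarrow> x" by blast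
  \<comment> \<open>Whichever corner \<open>G\<close> of the cells is chosen, it differs from the
    corner \<open>Q\<close> by at most one grid step per coordinate and so has the same
    limit.\<close>
  have near: "(\<lambda>l. pt (Suc (r l)) (G (Suc (r l)))) \<longlonglongrightarrow> x"
    if G: "\<And>p j. 0 < p \<Longrightarrow> j < n \<Longrightarrow> Q p j \<le> G p j \<and> G p j \<le> Q p j + 1" for G
  proof (rule tendsto_coordinatewise)
    fix a
    have lim: "(\<lambda>l. X (r l) a) \<longlonglongrightarrow> x a" using tendsto_coordinate[OF x(3), of a] by simp
    have "(\<lambda>l. 1 / real (Suc l)) \<longlonglongrightarrow> 0" using LIMSEQ_inverse_real_of_nat by (simp add: inverse_eq_divide)
    from LIMSEQ_subseq_LIMSEQ[OF this x(2)] have lim0: "(\<lambda>l. 1 / real (Suc (r l))) \<longlonglongrightarrow> 0" by (simp add: o_def)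
    have "(\<lambda>l. pt (Suc (r l)) (G (Suc (r l))) a - X (r l) a) \<longlonglongrightarrow> 0"
    proof (rule Lim_null_comparison[OF _ lim0], rule always_eventually, rule allI)
      fix l
      show "norm (pt (Suc (r l)) (G (Suc (r l))) a - X (r l) a) \<le> 1 / real (Suc (r l))"
      proof (cases "a \<in> A")
        case True
        then have "Q (Suc (r l)) (h' a) \<le> G (Suc (r l)) (h' a)" "G (Suc (r l)) (h' a) \<le> Q (Suc (r l)) (h' a) + 1"
          using G[of "Suc (r l)" "h' a"] h'[of a] by auto
        then have "\<bar>real (G (Suc (r l)) (h' a)) - real (Q (Suc (r l)) (h' a))\<bar> \<le> 1" by linarith
        moreover have "pt (Suc (r l)) (G (Suc (r l))) a - X (r l) a =
          (real (G (Suc (r l)) (h' a)) - real (Q (Suc (r l)) (h' a))) / real (Suc (r l))"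
          using True by (simp add: X_def pt_def diff_divide_distrib)
        ultimately show ?thesis by (simp add: abs_divide divide_right_mono)
      qed (auto simp: X_def pt_def)
    qed
    from tendsto_add[OF this lim] show "(\<lambda>l. pt (Suc (r l)) (G (Suc (r l))) a) \<longlonglongrightarrow> x a" by simp
  qed
  have "f x a = x a" if a: "a \<in> A" for a
  proof -
    define i where "i = h' a"
    have i: "i < n" "h i = a" using h' a by (auto simp: i_def)
    have lims: "(\<lambda>l. f (pt (Suc (r l)) (G (Suc (r l)))) a) \<longlonglongrightarrow> f x a" "(\<lambda>l. pt (Suc (r l)) (G (Suc (r l))) a) \<longlonglongrightarrow> x a"
      if G: "\<And>p j. 0 < p \<Longrightarrow> j < n \<Longrightarrow> Q p j \<le> G p j \<and> G p j \<le> Q p j + 1" for G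
    proof -
      have "pt (Suc (r l)) (G (Suc (r l))) \<in> box01" for l
        using G[of "Suc (r l)"] Q(1)[of "Suc (r l)"] by (intro pt) (force simp: Suc_le_eq dest: order_trans)
      then show "(\<lambda>l. f (pt (Suc (r l)) (G (Suc (r l)))) a) \<longlonglongrightarrow> f x a"
        by (intro continuous_on_tendsto_compose[OF cont[OF a] near[OF G] x(1)]) auto
      show "(\<lambda>l. pt (Suc (r l)) (G (Suc (r l))) a) \<longlonglongrightarrow> x a" using tendsto_coordinate[OF near[OF G]] .
    qed
    have "x a \<le> f x a"
      by (rule LIMSEQ_le[OF lims(2)[of "\<lambda>p. R p i"] lims(1)[of "\<lambda>p. R p i"]])
        (use RS i le lab0 in auto)
    moreover have "f x a \<le> x a"
      by (rule LIMSEQ_le[OF lims(1)[of "\<lambda>p. S p i"] lims(2)[of "\<lambda>p. S p i"]])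
        (use RS i le lab1 in auto)
    ultimately show ?thesis by simp
  qed
  then show ?thesis using x by blast
qed

subsection \<open>Freudenthal triangulation\<close>

text \<open>
  Freudenthal's triangulation, cut out by the hyperplanes on which some \<open>N c\<^sub>p\<close> or some difference
  \<open>N c\<^sub>p - N c\<^sub>q\<close> is an integer, also triangulates the partitions and all their faces. The grid
  points spanning the cell of \<open>c\<close> are those whose offsets \<open>N (c - v)\<close> pairwise differ by less than 1;
  since a cut point at 0 has offset 0, this bounds the offsets themselves.
\<close>

definition grid :: "nat \<Rightarrow> nat \<Rightarrow> nat \<Rightarrow> (nat \<Rightarrow> nat \<Rightarrow> real) set" where
  "grid d m N = {v. partition_cuts d m v \<and> (\<forall>k j. real N * v k j \<in> \<int>)}"

definition offset :: "nat \<Rightarrow> (nat \<Rightarrow> nat \<Rightarrow> real) \<Rightarrow> (nat \<Rightarrow> nat \<Rightarrow> real) \<Rightarrow> nat \<times> nat \<Rightarrow> real" where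
  "offset N c v = (\<lambda>(k, j). real N * (c k j - v k j))"

text \<open>A substitute for barycentric coordinates: among grid points it is positive exactly at
  those spanning the cell of \<open>c\<close>, and its product form makes it continuous in
  \<open>c\<close>.\<close>

definition grid_weight ::
  "nat \<Rightarrow> nat \<Rightarrow> nat \<Rightarrow> (nat \<Rightarrow> nat \<Rightarrow> real) \<Rightarrow> (nat \<Rightarrow> nat \<Rightarrow> real) \<Rightarrow> real" where
  "grid_weight d m N c v =
     (\<Prod>p\<in>{..<d} \<times> {..m}. \<Prod>q\<in>{..<d} \<times> {..m}. max 0 (1 - (offset N c v p - offset N c v q)))"

lemma partition_cuts_mono:
  assumes "partition_cuts d m c" "k < d" "i \<le> j" "j \<le> m"
  shows "c k i \<le> c k j"
  using assms(3,4)
proof (induction j rule: dec_induct)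
  case (step j)
  then show ?case using assms(1,2) unfolding partition_cuts_def
    by (metis Suc_le_lessD Suc_leD order_trans)
qed simp

lemma partition_cuts_bounds:
  assumes "partition_cuts d m c"
  shows "0 \<le> c k j \<and> c k j \<le> 1"
proof (cases "k < d \<and> j \<le> m")
  case True
  then show ?thesis using partition_cuts_mono[OF assms, of k 0 j] partition_cuts_mono[OF assms, of k j m] assms
    by (auto simp: partition_cuts_def)
next
  case False
  then show ?thesis using assms by (auto simp: partition_cuts_def not_less not_le)
qed

lemma partition_cuts_outside:
  assumes "partition_cuts d m c" "\<not> (k < d \<and> j \<le> m)"
  shows "c k j = 0"
  using assms by (auto simp: partition_cuts_def not_less not_le)

lemma finite_grid:
  assumes "0 < N"
  shows "finite (grid d m N)"
proof -
  define B where "B = (\<lambda>i. real i / real N) ` {..N}"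
  define R where "R = {f :: nat \<Rightarrow> real. \<forall>j. (j \<in> {..m} \<longrightarrow> f j \<in> B) \<and> (j \<notin> {..m} \<longrightarrow> f j = 0)}"
  define G where "G = {g :: nat \<Rightarrow> nat \<Rightarrow> real. \<forall>k. (k \<in> {..<d} \<longrightarrow> g k \<in> R) \<and> (k \<notin> {..<d} \<longrightarrow> g k = (\<lambda>_. 0))}"
  have "finite R" unfolding R_def B_def by (intro finite_set_of_finite_funs) auto
  then have "finite G" unfolding G_def by (intro finite_set_of_finite_funs) auto
  moreover have "grid d m N \<subseteq> G"
  proof
    fix v assume v: "v \<in> grid d m N"
    then have pc: "partition_cuts d m v" and int: "\<And>k j. real N * v k j \<in> \<int>" by (auto simp: grid_def)
    have "v k j \<in> B" for k j
    proof -
      obtain z where z: "real N * v k j = of_int z" using int[of k j] by (rule Ints_cases)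
      have "0 \<le> real N * v k j" "real N * v k j \<le> real N * 1"
        using partition_cuts_bounds[OF pc, of k j] by (auto intro!: mult_left_le)
      then have "0 \<le> z" "z \<le> int N" unfolding z by linarith+
      moreover have "v k j = of_int z / real N" using z assms by (simp add: eq_divide_eq mult.commute)
      ultimately have "v k j = real (nat z) / real N" "nat z \<in> {..N}" by auto
      then show ?thesis unfolding B_def by (rule image_eqI)
    qed
    then show "v \<in> G" using partition_cuts_outside[OF pc] by (simp add: G_def R_def fun_eq_iff)
  qed
  ultimately show ?thesis by (rule finite_subset[rotated])
qed

lemma grid_weight_nonneg: "0 \<le> grid_weight d m N c v"
  unfolding grid_weight_def by (intro prod_nonneg) auto

lemma grid_weight_pos_iff:
  "0 < grid_weight d m N c v \<longleftrightarrow>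
     (\<forall>p\<in>{..<d} \<times> {..m}. \<forall>q\<in>{..<d} \<times> {..m}. offset N c v p - offset N c v q < 1)"
proof -
  have "0 < grid_weight d m N c v \<longleftrightarrow> grid_weight d m N c v \<noteq> 0"
    using grid_weight_nonneg[of d m N c v] by auto
  also have "\<dots> \<longleftrightarrow> (\<forall>p\<in>{..<d} \<times> {..m}. \<forall>q\<in>{..<d} \<times> {..m}. max 0 (1 - (offset N c v p - offset N c v q)) \<noteq> 0)"
    unfolding grid_weight_def by (simp add: prod_zero_iff)
  also have "\<dots> \<longleftrightarrow> (\<forall>p\<in>{..<d} \<times> {..m}. \<forall>q\<in>{..<d} \<times> {..m}. offset N c v p - offset N c v q < 1)"
    by (intro ball_cong refl) (auto simp: max_def)
  finally show ?thesis .
qed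

lemma grid_weightD:
  assumes "0 < grid_weight d m N c v" "k < d" "j \<le> m" "k' < d" "j' \<le> m"
  shows "real N * (c k j - v k j) - real N * (c k' j' - v k' j') < 1"
  using assms(1)[unfolded grid_weight_pos_iff, rule_format, of "(k, j)" "(k', j')"] assms(2-)
  by (simp add: offset_def)

lemma grid_weight_close:
  assumes "0 < grid_weight d m N c v" "partition_cuts d m c" "partition_cuts d m v" "0 < N"
  shows "\<bar>v k j - c k j\<bar> < 1 / real N"
proof (cases "k < d \<and> j \<le> m")
  case True
  have "\<bar>real N * (c k j - v k j)\<bar> < 1"
    using grid_weightD[OF assms(1), of k j k 0] grid_weightD[OF assms(1), of k 0 k j] True assms(2,3)
    by (auto simp: partition_cuts_def)
  then have "real N * \<bar>v k j - c k j\<bar> < 1" by (simp add: abs_mult abs_minus_commute)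
  then show ?thesis using assms(4) by (simp add: field_simps)
next
  case False
  then show ?thesis using assms(2-4) by (auto simp: partition_cuts_def not_less not_le)
qed

lemma Ints_less_one_le:
  assumes "a \<in> \<int>" "b \<in> \<int>" "a < (b :: real)"
  shows "a + 1 \<le> b"
proof -
  obtain i j where "a = of_int i" "b = of_int j" using assms(1,2) by (metis Ints_cases)
  moreover from this have "i + 1 \<le> j" using assms(3) by simp
  then have "(of_int (i + 1) :: real) \<le> of_int j" by (simp only: of_int_le_iff)
  ultimately show ?thesis by simp
qed

text \<open>This makes the triangulation respect faces: distinct cut points of the grid point
  \<open>v\<close> are at least \<open>1 / N\<close> apart, so if they coincided in \<open>c\<close>
  their offsets would differ by at least 1.\<close>

lemma grid_weight_carrier:
  assumes "0 < grid_weight d m N c v" "v \<in> grid d m N" "0 < N" "k < d" "j < m" "c k j = c k (Suc j)"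
  shows "v k j = v k (Suc j)"
proof (rule ccontr)
  assume "v k j \<noteq> v k (Suc j)"
  moreover have "v k j \<le> v k (Suc j)" using assms(2,4,5) by (simp add: grid_def partition_cuts_def)
  ultimately have "v k j < v k (Suc j)" by simp
  then have "real N * v k j + 1 \<le> real N * v k (Suc j)"
    using assms(2,3) by (intro Ints_less_one_le) (auto simp: grid_def)
  then show False using grid_weightD[OF assms(1), of k j k "Suc j"] assms(4-6)
    by (simp add: right_diff_distrib)
qed

text \<open>If each of \<open>v\<close> and \<open>w\<close> were larger somewhere, integrality
  would give two scaled gaps of at least 1, whereas the two offset bounds for these positions add up
  to less than 2.\<close>

lemma grid_weight_comparable:
  assumes "0 < grid_weight d m N c v" "v \<in> grid d m N" "0 < grid_weight d m N c w" "w \<in> grid d m N" "0 < N"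
  shows "(\<forall>k j. v k j \<le> w k j) \<or> (\<forall>k j. w k j \<le> v k j)"
proof (rule ccontr)
  assume "\<not> ?thesis"
  then obtain k j k' j' where *: "w k j < v k j" "v k' j' < w k' j'" by (auto simp: not_le)
  have I: "k < d" "j \<le> m" "k' < d" "j' \<le> m"
    using * assms(2,4) partition_cuts_outside[of d m v] partition_cuts_outside[of d m w]
    unfolding grid_def by (metis (mono_tags) less_irrefl mem_Collect_eq)+
  have "real N * w k j + 1 \<le> real N * v k j" "real N * v k' j' + 1 \<le> real N * w k' j'"
    using * assms by (auto intro!: Ints_less_one_le simp: grid_def)
  then show False
    using grid_weightD[OF assms(3), of k j k' j'] grid_weightD[OF assms(1), of k' j' k j] I
    by (simp add: algebra_simps)
qed

text \<open>Both grid points are within \<open>1 / N\<close> of \<open>c\<close>, so their scaled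
  cut points are integers less than 2 apart.\<close>

lemma grid_weight_step:
  assumes "0 < grid_weight d m N c v" "v \<in> grid d m N" "0 < grid_weight d m N c w" "w \<in> grid d m N"
    "partition_cuts d m c" "0 < N"
  shows "real N * w k j \<le> real N * v k j + 1"
proof (rule ccontr)
  assume "\<not> ?thesis"
  then have "real N * v k j + 1 < real N * w k j" by simp
  then have *: "real N * v k j + 2 \<le> real N * w k j"
    using Ints_less_one_le[of "real N * v k j + 1" "real N * w k j"] assms(2,4) by (auto simp: grid_def)
  have "\<bar>v k j - c k j\<bar> < 1 / real N" "\<bar>w k j - c k j\<bar> < 1 / real N"
    using assms by (auto intro!: grid_weight_close simp: grid_def)
  then have "w k j - v k j < 2 / real N" by linarith
  then show False using * \<open>0 < N\<close> by (simp add: field_simps)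
qed

text \<open>The sum runs over the \<open>d * (m - 1)\<close> interior cut points, the only ones a
  partition leaves free.\<close>

definition height :: "nat \<Rightarrow> nat \<Rightarrow> nat \<Rightarrow> (nat \<Rightarrow> nat \<Rightarrow> real) \<Rightarrow> real" where
  "height d m N v = (\<Sum>(k, j)\<in>{..<d} \<times> {1..<m}. real N * v k j)"

text \<open>The vertices of a cell form a chain, so \<open>height\<close> is injective on them. Its
  values there are integers within \<open>d * (m - 1)\<close> of the least one, since each interior
  cut point rises by at most one grid step.\<close>

lemma card_grid_support:
  assumes c: "partition_cuts d m c" and "0 < N" "0 < m"
    and S: "S \<subseteq> grid d m N" "\<And>v. v \<in> S \<Longrightarrow> 0 < grid_weight d m N c v"
  shows "card S \<le> d * (m - 1) + 1"
proof (cases "S = {}")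
  case False
  let ?I = "{..<d} \<times> {1..<m}"
  let ?h = "height d m N"
  have fin: "finite S" using S(1) finite_grid[OF \<open>0 < N\<close>] finite_subset by blast
  have int: "?h v \<in> \<int>" if "v \<in> S" for v
    unfolding height_def using that S(1) by (intro Ints_sum) (auto simp: grid_def)
  have le: "?h w \<le> ?h v + real (d * (m - 1))" if "v \<in> S" "w \<in> S" for v w
  proof -
    have "?h w \<le> (\<Sum>(k, j)\<in>?I. real N * v k j + 1)"
      unfolding height_def using grid_weight_step[OF S(2)[OF that(1)] _ S(2)[OF that(2)] _ c \<open>0 < N\<close>] that S(1)
      by (intro sum_mono) auto
    also have "\<dots> = ?h v + (\<Sum>p\<in>?I. 1)" unfolding height_def
      by (simp add: case_prod_unfold sum.distrib)
    finally show ?thesis by (simp add: card_cartesian_product)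
  qed
  have inj: "inj_on ?h S"
  proof (rule inj_onI)
    fix v w assume vw: "v \<in> S" "w \<in> S" "?h v = ?h w"
    have eq: "v = w" if le: "\<forall>k j. v k j \<le> w k j" and "v \<in> S" "w \<in> S" "?h v = ?h w" for v w
    proof (intro ext)
      fix k j
      have pc: "partition_cuts d m v" "partition_cuts d m w" using that S(1) by (auto simp: grid_def)
      show "v k j = w k j"
      proof (cases "(k, j) \<in> ?I")
        case True
        have "(\<lambda>(k, j). real N * v k j) (k, j) = (\<lambda>(k, j). real N * w k j) (k, j)"
          by (rule sum_mono_inv[of _ ?I])
            (use that True in \<open>auto simp: height_def intro!: mult_left_mono\<close>)
        then show ?thesis using \<open>0 < N\<close> by simp
      next
        case False
        then have "d \<le> k \<or> m < j \<or> j = 0 \<or> j = m" by auto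
        then show ?thesis using pc by (cases "k < d") (auto simp: partition_cuts_def)
      qed
    qed
    show "v = w"
      using grid_weight_comparable[OF S(2)[OF vw(1)] _ S(2)[OF vw(2)] _ \<open>0 < N\<close>] vw S(1)
        eq[OF _ vw] eq[OF _ vw(2,1) vw(3)[symmetric]] by blast
  qed
  define a where "a = Min (?h ` S)"
  have "a \<in> ?h ` S" unfolding a_def using fin False by (intro Min_in) auto
  then obtain v0 where v0: "v0 \<in> S" "a = ?h v0" by blast
  have "?h ` S \<subseteq> (\<lambda>i. a + real i) ` {..d * (m - 1)}"
  proof
    fix y assume "y \<in> ?h ` S"
    then obtain w where w: "w \<in> S" "y = ?h w" by blast
    have "a \<le> y" using w fin by (simp add: a_def)
    moreover have "y - a \<in> \<int>" using int w v0 by auto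
    ultimately obtain i where i: "y - a = real i"
      by (metis Ints_cases diff_ge_0_iff_ge of_int_0_le_iff of_int_of_nat_eq zero_le_imp_eq_int)
    then have "i \<le> d * (m - 1)" using le[OF v0(1) w(1)] v0 w by (metis add_le_cancel_left of_nat_le_iff diff_add_cancel add.commute)
    then show "y \<in> (\<lambda>i. a + real i) ` {..d * (m - 1)}" using i by (auto simp: algebra_simps intro!: image_eqI[of _ _ i])
  qed
  then have "card (?h ` S) \<le> card ((\<lambda>i. a + real i) ` {..d * (m - 1)})" by (intro card_mono) auto
  also have "\<dots> \<le> card {..d * (m - 1)}" by (rule card_image_le) simp
  finally show ?thesis using inj by (simp add: card_image)
qed simp

lemma ex_grid_weight_pos:
  assumes "partition_cuts d m c" "0 < N"
  shows "\<exists>v\<in>grid d m N. 0 < grid_weight d m N c v"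
proof -
  \<comment> \<open>Rounding every cut point down leaves offsets in \<open>[0,1)\<close>, whose
    differences are less than 1.\<close>
  define v where "v k j = of_int \<lfloor>real N * c k j\<rfloor> / real N" for k j
  have Nv: "real N * v k j = of_int \<lfloor>real N * c k j\<rfloor>" for k j using assms(2) by (simp add: v_def)
  have "v k j \<le> v k (Suc j)" if "k < d" "j < m" for k j
    unfolding v_def using assms that
    by (auto intro!: divide_right_mono floor_mono mult_left_mono simp: partition_cuts_def)
  then have "v \<in> grid d m N" using assms
    by (auto simp: grid_def Nv, auto simp: partition_cuts_def v_def)
  moreover have "0 < grid_weight d m N c v" unfolding grid_weight_pos_iff offset_def
    by (auto simp: right_diff_distrib Nv) linarith
  ultimately show ?thesis by blast
qed

lemma continuous_on_grid_weight:
  assumes "\<And>k j. continuous_on S (\<lambda>x. c x k j)"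
  shows "continuous_on S (\<lambda>x. grid_weight d m N (c x) v)"
  unfolding grid_weight_def offset_def case_prod_unfold using assms by (intro continuous_intros) auto

subsection \<open>Barycentric subdivision\<close>

definition has_rank :: "nat set \<Rightarrow> nat \<Rightarrow> nat \<Rightarrow> bool" where
  "has_rank B r x \<longleftrightarrow> x \<in> B \<and> card {y \<in> B. y < x} = r"

lemma ex_has_rank:
  assumes "finite B" "r < card B"
  shows "\<exists>x. has_rank B r x"
  using assms
proof (induction "card B" arbitrary: B)
  case (Suc n)
  have B: "B \<noteq> {}" "finite B" using Suc.hyps(2) Suc.prems(1) by force+
  have M: "Max B \<in> B" using B by simp
  show ?case
  proof (cases "r = n")
    case True
    have "{y \<in> B. y < Max B} = B - {Max B}" using B by (auto simp: less_le)
    then have "card {y \<in> B. y < Max B} = n" using Suc(2) M B by simp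
    then show ?thesis using True M by (auto simp: has_rank_def)
  next
    case False
    have "\<exists>x. has_rank (B - {Max B}) r x"
      proof (rule Suc.hyps(1))
      show "n = card (B - {Max B})" using Suc.hyps(2) M by simp
      then show "r < card (B - {Max B})" using Suc.hyps(2) Suc.prems(2) False by linarith
    qed (use B in simp)
    then obtain x where x: "x \<in> B - {Max B}" "card {y \<in> B - {Max B}. y < x} = r"
      by (auto simp: has_rank_def)
    have "x \<le> Max B" using x B by auto
    then have "{y \<in> B - {Max B}. y < x} = {y \<in> B. y < x}" by auto
    then show ?thesis using x by (auto simp: has_rank_def)
  qed
qed simp

text \<open>If \<open>x \<le> y\<close>, the \<open>r\<close> elements of \<open>A\<close> below
  \<open>x\<close> would be among the \<open>s\<close> elements of \<open>B\<close> below
  \<open>y\<close>, against \<open>s < r\<close>.\<close>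

lemma has_rank_less:
  assumes "A \<subseteq> B" "finite B" "has_rank A r x" "has_rank B s y" "s < r"
  shows "y < x"
proof (rule ccontr)
  assume "\<not> y < x"
  then have "{z \<in> A. z < x} \<subseteq> {z \<in> B. z < y}" using assms(1) by auto
  moreover have "finite {z \<in> B. z < y}" using assms(2) by simp
  ultimately have "r \<le> s" using assms(3,4) card_mono unfolding has_rank_def by metis
  then show False using assms by simp
qed

text \<open>
  If \<open>\<phi>\<close> are barycentric coordinates with respect to a triangulation with vertex set \<open>V\<close>, the sets
  of positive weight are the vertices of the barycentric subdivision spanning the current cell.
\<close>

definition bary_weight :: "'v set \<Rightarrow> ('v \<Rightarrow> real) \<Rightarrow> 'v set \<Rightarrow> real" where
  "bary_weight V \<phi> \<sigma> = (\<Prod>v\<in>\<sigma>. \<Prod>u\<in>V - \<sigma>. max 0 (\<phi> v - \<phi> u)) * (\<Prod>v\<in>\<sigma>. \<phi> v)"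

lemma bary_weight_nonneg:
  assumes "\<And>v. v \<in> V \<Longrightarrow> 0 \<le> \<phi> v" "\<sigma> \<subseteq> V"
  shows "0 \<le> bary_weight V \<phi> \<sigma>"
  unfolding bary_weight_def using assms by (intro mult_nonneg_nonneg prod_nonneg) auto

text \<open>The condition says that \<open>\<sigma>\<close> is a superlevel set of
  \<open>\<phi>\<close> inside its support. The empty set satisfies it too, with weight 1.\<close>

lemma bary_weight_pos_iff:
  assumes "finite V" "\<And>v. v \<in> V \<Longrightarrow> 0 \<le> \<phi> v" "\<sigma> \<subseteq> V"
  shows "0 < bary_weight V \<phi> \<sigma> \<longleftrightarrow> (\<forall>v\<in>\<sigma>. 0 < \<phi> v \<and> (\<forall>u\<in>V - \<sigma>. \<phi> u < \<phi> v))"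
proof -
  have fin: "finite \<sigma>" using assms finite_subset by blast
  have "0 < bary_weight V \<phi> \<sigma> \<longleftrightarrow> bary_weight V \<phi> \<sigma> \<noteq> 0"
    using bary_weight_nonneg[of V \<phi> \<sigma>, OF assms(2,3)] by auto
  also have "\<dots> \<longleftrightarrow> (\<forall>v\<in>\<sigma>. \<phi> v \<noteq> 0) \<and> (\<forall>v\<in>\<sigma>. \<forall>u\<in>V - \<sigma>. max 0 (\<phi> v - \<phi> u) \<noteq> 0)"
    using fin assms(1) by (auto simp: bary_weight_def)
  also have "\<dots> \<longleftrightarrow> (\<forall>v\<in>\<sigma>. 0 < \<phi> v \<and> (\<forall>u\<in>V - \<sigma>. \<phi> u < \<phi> v))"
  proof -
    have "max 0 (\<phi> v - \<phi> u) \<noteq> 0 \<longleftrightarrow> \<phi> u < \<phi> v" for u v by auto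
    moreover have "\<phi> v \<noteq> 0 \<longleftrightarrow> 0 < \<phi> v" if "v \<in> \<sigma>" for v
      using assms(2)[of v] assms(3) that by auto
    ultimately show ?thesis by auto
  qed
  finally show ?thesis .
qed

text \<open>Superlevel sets of one function are nested.\<close>

lemma bary_weight_chain:
  assumes "finite V" "\<And>v. v \<in> V \<Longrightarrow> 0 \<le> \<phi> v" "\<sigma> \<subseteq> V" "\<tau> \<subseteq> V"
    and "0 < bary_weight V \<phi> \<sigma>" "0 < bary_weight V \<phi> \<tau>"
  shows "\<sigma> \<subseteq> \<tau> \<or> \<tau> \<subseteq> \<sigma>"
proof (rule ccontr)
  assume "\<not> ?thesis"
  then obtain a b where ab: "a \<in> \<sigma>" "a \<notin> \<tau>" "b \<in> \<tau>" "b \<notin> \<sigma>" by blast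
  then have "\<phi> b < \<phi> a" "\<phi> a < \<phi> b"
    using assms(3-6) bary_weight_pos_iff[OF assms(1,2,3)] bary_weight_pos_iff[OF assms(1,2,4)] by auto
  then show False by simp
qed

lemma ex_bary_weight_pos:
  assumes "finite V" "\<And>v. v \<in> V \<Longrightarrow> 0 \<le> \<phi> v" "v0 \<in> V" "0 < \<phi> v0"
  shows "\<exists>\<sigma>\<subseteq>V. \<sigma> \<noteq> {} \<and> 0 < bary_weight V \<phi> \<sigma>"
proof -
  define M where "M = Max (\<phi> ` V)"
  have le: "\<phi> v \<le> M" if "v \<in> V" for v using that assms by (simp add: M_def)
  have "M \<in> \<phi> ` V" unfolding M_def using assms by (intro Max_in) auto
  moreover have "0 < M" using le assms by fastforce
  moreover have "{v \<in> V. \<phi> v = M} \<subseteq> V" by auto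
  moreover have "\<phi> u < M" if "u \<in> V - {v \<in> V. \<phi> v = M}" for u
    using le[of u] that by (simp add: order_less_le)
  ultimately show ?thesis
    by (intro exI[of _ "{v \<in> V. \<phi> v = M}"] conjI iffD2[OF bary_weight_pos_iff[OF assms(1,2)]]) auto
qed

lemma continuous_on_bary_weight:
  assumes "\<And>v. v \<in> V \<Longrightarrow> continuous_on S (\<lambda>x. \<phi> x v)" "\<sigma> \<subseteq> V"
  shows "continuous_on S (\<lambda>x. bary_weight V (\<phi> x) \<sigma>)"
  unfolding bary_weight_def using assms by (intro continuous_intros) auto

subsection \<open>Face-preserving maps of the polytope of partitions\<close>

text \<open>Running maxima turn arbitrary coordinates into nondecreasing cut points and leave
  nonnegative nondecreasing ones, indexed from 1, unchanged.\<close>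

fun runmax :: "(nat \<times> nat \<Rightarrow> real) \<Rightarrow> nat \<Rightarrow> nat \<Rightarrow> real" where
  "runmax x k 0 = 0"
| "runmax x k (Suc j) = max (runmax x k j) (x (k, Suc j))"

text \<open>
  A retraction of the cube onto partitions: only the coordinates \<open>(k, j)\<close> with \<open>1 \<le> j < m\<close> matter.
\<close>

definition box_cuts :: "nat \<Rightarrow> nat \<Rightarrow> (nat \<times> nat \<Rightarrow> real) \<Rightarrow> nat \<Rightarrow> nat \<Rightarrow> real" where
  "box_cuts d m x k j = (if d \<le> k \<or> m < j then 0 else if j = m then 1 else runmax x k j)"

lemma runmax_le_1: "x \<in> box01 \<Longrightarrow> runmax x k j \<le> 1"
  by (induction j) (auto simp: box01_def)

lemma partition_cuts_box_cuts:
  assumes "x \<in> box01" "0 < m"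
  shows "partition_cuts d m (box_cuts d m x)"
  using assms runmax_le_1[OF assms(1)] by (auto simp: partition_cuts_def box_cuts_def)

lemma continuous_on_runmax: "continuous_on S (\<lambda>x. runmax x k j)"
proof (induction j)
  case (Suc j)
  have "continuous_on S (\<lambda>x. x (k, Suc j))"
    by (rule continuous_on_subset[OF continuous_on_product_coordinates]) simp
  then show ?case using Suc by (simp add: continuous_on_max)
qed simp

lemma continuous_on_box_cuts: "continuous_on S (\<lambda>x. box_cuts d m x k j)"
  unfolding box_cuts_def by (cases "d \<le> k \<or> m < j"; cases "j = m") (auto simp: continuous_on_runmax)

text \<open>
  Gale's trick: lengthen the piece \<open>j\<close> of cake \<open>k\<close> by the shortfall of \<open>F c k j\<close> below \<open>1/m\<close> and
  renormalise. At a fixed point with a positive shortfall in cake \<open>k\<close> every piece is nonempty with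
  \<open>F c k j < 1/m\<close>, contradicting the sum being 1.
\<close>

lemma carrier_preserving_hits_barycenter:
  fixes F :: "(nat \<Rightarrow> nat \<Rightarrow> real) \<Rightarrow> nat \<Rightarrow> nat \<Rightarrow> real"
  assumes "0 < m"
    and nonneg: "\<And>c k j. partition_cuts d m c \<Longrightarrow> k < d \<Longrightarrow> j < m \<Longrightarrow> 0 \<le> F c k j"
    and sum1: "\<And>c k. partition_cuts d m c \<Longrightarrow> k < d \<Longrightarrow> (\<Sum>j<m. F c k j) = 1"
    and carrier: "\<And>c k j. partition_cuts d m c \<Longrightarrow> k < d \<Longrightarrow> j < m \<Longrightarrow> c k j = c k (Suc j) \<Longrightarrow> F c k j = 0"
    and cont: "\<And>(S :: (nat \<times> nat \<Rightarrow> real) set) C k j. (\<And>k j. continuous_on S (\<lambda>x. C x k j)) \<Longrightarrow>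
      (\<And>x. x \<in> S \<Longrightarrow> partition_cuts d m (C x)) \<Longrightarrow> k < d \<Longrightarrow> j < m \<Longrightarrow> continuous_on S (\<lambda>x. F (C x) k j)"
  shows "\<exists>c. partition_cuts d m c \<and> (\<forall>k<d. \<forall>j<m. F c k j = 1 / real m)"
proof -
  let ?C = "box_cuts d m"
  define shortfall where "shortfall c k j = max 0 (1 / real m - F c k j)" for c k j
  \<comment> \<open>The lengths of the pieces after Gale's modification; \<open>G\<close> below adds
    them up to new cut points.\<close>
  define L where "L c k j = (c k (Suc j) - c k j + shortfall c k j) / (1 + (\<Sum>j<m. shortfall c k j))" for c k j
  have shortfall_nonneg: "0 \<le> shortfall c k j" for c k j by (simp add: shortfall_def)
  have den: "0 < 1 + (\<Sum>j<m. shortfall c k j)" for c k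
    using sum_nonneg[of "{..<m}" "shortfall c k"] shortfall_nonneg by (simp add: add_pos_nonneg)
  have L0: "0 \<le> L c k j" if "partition_cuts d m c" "k < d" "j < m" for c k j
    unfolding L_def using that shortfall_nonneg[of c k j] den[of c k]
    by (intro divide_nonneg_pos) (auto simp: partition_cuts_def)
  have Lsum: "(\<Sum>j<m. L c k j) = 1" if "partition_cuts d m c" "k < d" for c k
  proof -
    have "(\<Sum>j<m. c k (Suc j) - c k j) = 1" unfolding sum_lessThan_telescope
      using that by (simp add: partition_cuts_def)
    then show ?thesis unfolding L_def using den[of c k]
      by (simp add: sum.distrib flip: sum_divide_distrib)
  qed
  define G where "G x p = (\<Sum>i<snd p. L (?C x) (fst p) i)" for x p
  have "\<exists>x\<in>box01. \<forall>p\<in>{..<d} \<times> {1..<m}. G x p = x p"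
  proof (rule brouwer_box01)
    fix p assume p: "p \<in> {..<d} \<times> {1..<m}"
    have "continuous_on box01 (\<lambda>x. F (?C x) (fst p) j)" if "j < m" for j
      using p that \<open>0 < m\<close> by (intro cont continuous_on_box_cuts partition_cuts_box_cuts) auto
    then have "continuous_on box01 (\<lambda>x. shortfall (?C x) (fst p) j)" if "j < m" for j
      unfolding shortfall_def using that by (intro continuous_intros) auto
    then show "continuous_on box01 (\<lambda>x. G x p)" unfolding G_def L_def
      using p den less_imp_neq[OF den]
      by (intro continuous_intros continuous_on_box_cuts) (force)+
  next
    fix x :: "nat \<times> nat \<Rightarrow> real" and p assume x: "x \<in> box01" and p: "p \<in> {..<d} \<times> {1..<m}"
    let ?L = "L (?C x) (fst p)"
    have pc: "partition_cuts d m (?C x)" using x \<open>0 < m\<close> by (rule partition_cuts_box_cuts)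
    have "sum ?L {..<snd p} \<le> sum ?L {..<m}" using p L0[OF pc] by (intro sum_mono2) auto
    moreover have "0 \<le> sum ?L {..<snd p}" using p L0[OF pc] by (intro sum_nonneg) auto
    moreover have "sum ?L {..<m} = 1" using Lsum[OF pc] p by auto
    ultimately show "G x p \<in> {0..1}" by (simp add: G_def)
  qed simp
  then obtain x where x: "x \<in> box01" and fp: "\<And>k j. k < d \<Longrightarrow> 1 \<le> j \<Longrightarrow> j < m \<Longrightarrow> G x (k, j) = x (k, j)" by force
  define c where "c = ?C x"
  have pc: "partition_cuts d m c" unfolding c_def using x \<open>0 < m\<close> by (rule partition_cuts_box_cuts)
  \<comment> \<open>At the fixed point the coordinates are partial sums of nonnegative lengths,
    hence already nondecreasing, and the retraction leaves them alone.\<close>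
  have run: "runmax x k j = (\<Sum>i<j. L c k i)" if "k < d" "j < m" for k j
    using that(2)
  proof (induction j)
    case (Suc j)
    have "x (k, Suc j) = (\<Sum>i<Suc j. L c k i)" using fp[of k "Suc j"] that Suc.prems by (simp add: G_def c_def)
    then show ?case using Suc L0[OF pc, of k j] that by simp
  qed simp
  have c_sum: "c k j = (\<Sum>i<j. L c k i)" if "k < d" "j \<le> m" for k j
  proof (cases "j = m")
    case True
    then show ?thesis using that pc Lsum[OF pc] by (simp add: partition_cuts_def)
  next
    case False
    then have "c k j = runmax x k j" using that by (simp add: c_def box_cuts_def)
    then show ?thesis using run that False by simp
  qed
  have "F c k j = 1 / real m" if k: "k < d" and j: "j < m" for k j
  proof -
    define s where "s = (\<Sum>j<m. shortfall c k j)"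
    have s: "0 \<le> s" unfolding s_def using shortfall_nonneg by (intro sum_nonneg) auto
    \<comment> \<open>The fixed point equation says that a length equals itself plus its shortfall,
      divided by \<open>1 + s\<close>; here the denominator is cleared.\<close>
    have eq: "(c k (Suc i) - c k i) * s = shortfall c k i" if "i < m" for i
    proof -
      have "c k (Suc i) - c k i = L c k i" using c_sum[OF k, of "Suc i"] c_sum[OF k, of i] that by simp
      also have "\<dots> = (c k (Suc i) - c k i + shortfall c k i) / (1 + s)" by (simp add: L_def s_def)
      finally show ?thesis using s by (simp add: field_simps)
    qed
    have "s = 0"
    proof (rule ccontr)
      assume "s \<noteq> 0"
      have "F c k i < 1 / real m" if i: "i < m" for i
      proof (cases "c k i = c k (Suc i)")
        case True
        then show ?thesis using carrier[OF pc k i] \<open>0 < m\<close> by simp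
      next
        case False
        then have "shortfall c k i \<noteq> 0" using eq[OF i] \<open>s \<noteq> 0\<close> by auto
        then show ?thesis unfolding shortfall_def by auto
      qed
      then have "(\<Sum>i<m. F c k i) < (\<Sum>i<m. 1 / real m)" using \<open>0 < m\<close> by (intro sum_strict_mono) auto
      then show False using sum1[OF pc k] \<open>0 < m\<close> by simp
    qed
    then have "1 / real m \<le> F c k i" if "i < m" for i using eq[OF that] by (simp add: shortfall_def max_def split: if_splits)
    moreover have "(\<Sum>i<m. 1 / real m) = (\<Sum>i<m. F c k i)" using sum1[OF pc k] \<open>0 < m\<close> by simp
    ultimately have "1 / real m = F c k j"
      using sum_mono_inv[of "\<lambda>_. 1 / real m" "{..<m}" "F c k" j] j by auto
    then show ?thesis by simp
  qed
  then show ?thesis using pc by blast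
qed

subsection \<open>Allocations\<close>

definition happy ::
  "nat \<Rightarrow> nat \<Rightarrow> nat \<Rightarrow> (nat \<Rightarrow> (nat \<Rightarrow> nat \<Rightarrow> real) \<Rightarrow> nat list \<Rightarrow> bool) \<Rightarrow> (nat \<Rightarrow> nat \<Rightarrow> real) \<Rightarrow> nat set" where
  "happy n m d pref c = {i. i < n \<and> (\<exists>t. dtuple d m t \<and> nonempty_tuple d c t \<and> pref i c t)}"

lemma card_happy:
  assumes "hungry n m d pref" "d * (m - 1) + 1 \<le> n" "partition_cuts d m c"
  shows "d * (m - 1) + 1 \<le> card (happy n m d pref c)"
proof (rule ccontr)
  let ?H = "happy n m d pref c"
  assume neg: "\<not> ?thesis"
  have "?H \<subseteq> {0..<n}" by (auto simp: happy_def)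
  then have "card ({0..<n} - ?H) = n - card ?H" by (subst card_Diff_subset) (auto intro: finite_subset)
  then have "n - d * (m - 1) \<le> card ({0..<n} - ?H)" using neg by simp
  then obtain I where I: "I \<subseteq> {0..<n} - ?H" "card I = n - d * (m - 1)"
    by (meson obtain_subset_with_card_n)
  then have "I \<subseteq> {0..<n}" by blast
  then obtain i t where "i \<in> I" "dtuple d m t" "nonempty_tuple d c t" "pref i c t"
    using assms(1,3) I(2) unfolding hungry_def by meson
  then show False using I(1) by (auto simp: happy_def)
qed

text \<open>The argument for one mesh \<open>1 / N\<close>. Disjointness and size are exact, but
  each preference holds only at some partition close to \<open>c\<close>, which may vary from player
  to player.\<close>

lemma approximate_allocation:
  assumes hungry: "hungry n m d pref" and "d * (m - 1) + 1 \<le> n" and "0 < m" "2 \<le> d" "0 < N"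
  shows "\<exists>c S alloc. partition_cuts d m c \<and> S \<subseteq> {0..<n} \<and> real m \<le> real (d - 1) * card S \<and>
    (\<forall>i\<in>S. dtuple d m (alloc i) \<and>
      (\<exists>v. partition_cuts d m v \<and> (\<forall>k j. \<bar>v k j - c k j\<bar> < 1 / real N) \<and> pref i v (alloc i))) \<and>
    (\<forall>i\<in>S. \<forall>i'\<in>S. i \<noteq> i' \<longrightarrow> (\<forall>k<d. alloc i ! k \<noteq> alloc i' ! k))"
proof -
  \<comment> \<open>Here \<open>D\<close> is the number of vertices of a full-dimensional simplex,
    one more than the dimension called \<open>D\<close> in the overview; the rank
    \<open>D - card \<sigma>\<close> is 0 for such a simplex.\<close>
  define D where "D = d * (m - 1) + 1"
  define V where "V = grid d m N"
  define H where "H = happy n m d pref"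
  define B where "B \<sigma> = \<Union> (H ` \<sigma>)" for \<sigma>
  \<comment> \<open>Sets that do not span a simplex are harmless, as their weight is always 0. The
    empty set has weight 1 but no vertex, so it is excluded; the bound \<open>D\<close> keeps the
    subtraction \<open>D - card \<sigma>\<close> exact.\<close>
  define Good where "Good = {\<sigma>. \<sigma> \<subseteq> V \<and> \<sigma> \<noteq> {} \<and> card \<sigma> \<le> D}"
  have finV: "finite V" unfolding V_def using \<open>0 < N\<close> by (rule finite_grid)
  then have finG: "finite Good" by (intro finite_subset[of Good "Pow V"]) (auto simp: Good_def)
  have pcV: "partition_cuts d m v" if "v \<in> V" for v using that by (simp add: V_def grid_def)
  have B_sub: "B \<sigma> \<subseteq> {0..<n}" for \<sigma> by (auto simp: B_def H_def happy_def)
  then have finB: "finite (B \<sigma>)" for \<sigma> using finite_subset by blast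
  have cardB: "D \<le> card (B \<sigma>)" if \<sigma>: "\<sigma> \<in> Good" for \<sigma>
  proof -
    obtain v where v: "v \<in> \<sigma>" "v \<in> V" using \<sigma> unfolding Good_def by blast
    have "D \<le> card (H v)" unfolding D_def H_def using assms(1,2) pcV[OF v(2)] by (rule card_happy)
    also have "\<dots> \<le> card (B \<sigma>)" using finB v by (intro card_mono) (auto simp: B_def)
    finally show ?thesis .
  qed
  have "\<exists>p v t. has_rank (B \<sigma>) (D - card \<sigma>) p \<and> v \<in> \<sigma> \<and> dtuple d m t \<and> nonempty_tuple d v t \<and> pref p v t"
    if "\<sigma> \<in> Good" for \<sigma>
  proof -
    have "0 < card \<sigma>" using that finV by (auto simp: Good_def card_gt_0_iff dest: finite_subset)
    then have "D - card \<sigma> < card (B \<sigma>)" using cardB[OF that] by (auto simp: D_def)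
    then obtain p where p: "has_rank (B \<sigma>) (D - card \<sigma>) p" using ex_has_rank finB by blast
    then have "p \<in> B \<sigma>" by (simp add: has_rank_def)
    then show ?thesis using p by (auto simp: B_def H_def happy_def)
  qed
  \<comment> \<open>\<open>P \<sigma>\<close> is the player assigned to \<open>\<sigma>\<close>, and
    \<open>W \<sigma>\<close> is a vertex of \<open>\<sigma>\<close> at which this player prefers
    the nonempty tuple \<open>t \<sigma>\<close>.\<close>
  then obtain P W t where PWt: "\<And>\<sigma>. \<sigma> \<in> Good \<Longrightarrow> has_rank (B \<sigma>) (D - card \<sigma>) (P \<sigma>) \<and> W \<sigma> \<in> \<sigma> \<and>
      dtuple d m (t \<sigma>) \<and> nonempty_tuple d (W \<sigma>) (t \<sigma>) \<and> pref (P \<sigma>) (W \<sigma>) (t \<sigma>)"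
    by metis
  have t_less: "t \<sigma> ! k < m" if "\<sigma> \<in> Good" "k < d" for \<sigma> k
    using PWt[OF that(1)] that(2) by (auto simp: dtuple_def)
  define \<beta> where "\<beta> c = bary_weight V (grid_weight d m N c)" for c
  have \<beta>0: "0 \<le> \<beta> c \<sigma>" if "\<sigma> \<in> Good" for c \<sigma>
    unfolding \<beta>_def using that by (intro bary_weight_nonneg grid_weight_nonneg) (auto simp: Good_def)
  have pos: "0 < grid_weight d m N c v" if "\<sigma> \<subseteq> V" "0 < \<beta> c \<sigma>" "v \<in> \<sigma>" for c \<sigma> v
    using that bary_weight_pos_iff[of V "grid_weight d m N c" \<sigma>, OF finV grid_weight_nonneg that(1)]
    unfolding \<beta>_def by simp
  define tot where "tot c = (\<Sum>\<sigma>\<in>Good. \<beta> c \<sigma>)" for c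
  have tot: "0 < tot c" if c: "partition_cuts d m c" for c
  proof -
    obtain v0 where "v0 \<in> V" "0 < grid_weight d m N c v0"
      using ex_grid_weight_pos[OF c \<open>0 < N\<close>] unfolding V_def by blast
    then obtain \<sigma> where \<sigma>: "\<sigma> \<subseteq> V" "\<sigma> \<noteq> {}" "0 < \<beta> c \<sigma>"
      using ex_bary_weight_pos[of V "grid_weight d m N c" v0, OF finV grid_weight_nonneg]
      unfolding \<beta>_def by auto
    have "card \<sigma> \<le> D" unfolding D_def
      using \<sigma>(1) pos[OF \<sigma>(1,3)] unfolding V_def by (rule card_grid_support[OF c \<open>0 < N\<close> \<open>0 < m\<close>])
    then have "\<sigma> \<in> Good" using \<sigma> by (simp add: Good_def)
    then show ?thesis unfolding tot_def using finG \<beta>0 \<sigma>(3) by (intro sum_pos2[of _ \<sigma>]) auto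
  qed
  \<comment> \<open>The normalised weight of all \<open>\<sigma>\<close> whose tuple uses piece
    \<open>j\<close> of cake \<open>k\<close>.\<close>
  define F where "F c k j = (\<Sum>\<sigma>\<in>Good. (if t \<sigma> ! k = j then 1 else 0) * \<beta> c \<sigma>) / tot c" for c k j
  have "\<exists>c. partition_cuts d m c \<and> (\<forall>k<d. \<forall>j<m. F c k j = 1 / real m)"
  proof (rule carrier_preserving_hits_barycenter[OF \<open>0 < m\<close>])
    fix c k j assume c: "partition_cuts d m c" "k < d" "j < m"
    show "0 \<le> F c k j" unfolding F_def using tot[OF c(1)] \<beta>0
      by (intro divide_nonneg_pos sum_nonneg) auto
  next
    fix c k assume c: "partition_cuts d m c" "k < d"
    have "(\<Sum>j<m. F c k j) = (\<Sum>\<sigma>\<in>Good. \<Sum>j<m. (if t \<sigma> ! k = j then 1 else 0) * \<beta> c \<sigma>) / tot c"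
      unfolding F_def by (subst sum.swap) (simp add: sum_divide_distrib)
    also have "(\<Sum>\<sigma>\<in>Good. \<Sum>j<m. (if t \<sigma> ! k = j then 1 else 0) * \<beta> c \<sigma>) = tot c"
      unfolding tot_def using t_less[OF _ c(2)]
      by (intro sum.cong) (auto simp: if_distrib[of "\<lambda>a. a * _"] cong: if_cong)
    finally show "(\<Sum>j<m. F c k j) = 1" using tot[OF c(1)] by simp
  next
    fix c k j assume c: "partition_cuts d m c" "k < d" "j < m" "c k j = c k (Suc j)"
    \<comment> \<open>A piece empty at \<open>c\<close> is empty at every grid point of positive
      weight, in particular at \<open>W \<sigma>\<close>, whereas \<open>t \<sigma>\<close> consists
      of nonempty pieces there.\<close>
    have "\<beta> c \<sigma> = 0" if \<sigma>: "\<sigma> \<in> Good" "t \<sigma> ! k = j" for \<sigma>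
    proof (rule ccontr)
      assume "\<beta> c \<sigma> \<noteq> 0"
      then have "0 < \<beta> c \<sigma>" using \<beta>0[OF \<sigma>(1), of c] by simp
      then have "0 < grid_weight d m N c (W \<sigma>)" using pos \<sigma> PWt[OF \<sigma>(1)] by (auto simp: Good_def)
      moreover have "W \<sigma> \<in> grid d m N" using \<sigma> PWt[OF \<sigma>(1)] by (auto simp: Good_def V_def)
      ultimately have "W \<sigma> k j = W \<sigma> k (Suc j)" using \<open>0 < N\<close> c(2-4) by (rule grid_weight_carrier)
      then show False using PWt[OF \<sigma>(1)] c(2) \<sigma>(2) by (auto simp: nonempty_tuple_def)
    qed
    then show "F c k j = 0" by (auto simp: F_def intro!: sum.neutral)
  next
    fix S :: "(nat \<times> nat \<Rightarrow> real) set" and C k j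
    assume C: "\<And>k j. continuous_on S (\<lambda>x. C x k j)" "\<And>x. x \<in> S \<Longrightarrow> partition_cuts d m (C x)"
    have "continuous_on S (\<lambda>x. \<beta> (C x) \<sigma>)" if "\<sigma> \<in> Good" for \<sigma>
      unfolding \<beta>_def using that C(1)
      by (intro continuous_on_bary_weight continuous_on_grid_weight) (auto simp: Good_def)
    moreover from this have "continuous_on S (\<lambda>x. tot (C x))"
      unfolding tot_def by (intro continuous_intros) auto
    moreover have "\<forall>x\<in>S. tot (C x) \<noteq> 0" using tot C(2) by fastforce
    ultimately show "continuous_on S (\<lambda>x. F (C x) k j)"
      unfolding F_def by (intro continuous_on_divide continuous_on_sum continuous_on_mult continuous_on_const) auto
  qed
  then obtain c where c: "partition_cuts d m c" and Fc: "\<And>k j. k < d \<Longrightarrow> j < m \<Longrightarrow> F c k j = 1 / real m" by blast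
  define J where "J = {\<sigma> \<in> Good. 0 < \<beta> c \<sigma>}"
  define e where "e \<sigma> k = t \<sigma> ! k" for \<sigma> k
  \<comment> \<open>The factor \<open>m\<close> turns the value \<open>1 / m\<close> of
    \<open>F\<close> into load 1 at each of the \<open>m\<close> vertices of a side, so the total
    weight is \<open>m\<close>.\<close>
  define w where "w \<sigma> = real m * \<beta> c \<sigma> / tot c" for \<sigma>
  have J: "finite J" "J \<subseteq> Good" using finG by (auto simp: J_def)
  have sumJ: "(\<Sum>\<sigma>\<in>J. f \<sigma> * w \<sigma>) = real m * (\<Sum>\<sigma>\<in>Good. f \<sigma> * \<beta> c \<sigma>) / tot c" for f
  proof -
    have "\<beta> c \<sigma> = 0" if "\<sigma> \<in> Good - J" for \<sigma> using that \<beta>0[of \<sigma> c] by (auto simp: J_def)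
    then have "(\<Sum>\<sigma>\<in>J. f \<sigma> * w \<sigma>) = (\<Sum>\<sigma>\<in>Good. f \<sigma> * w \<sigma>)"
      using finG J by (intro sum.mono_neutral_left) (auto simp: w_def)
    also have "\<dots> = real m * (\<Sum>\<sigma>\<in>Good. f \<sigma> * \<beta> c \<sigma>) / tot c"
      by (simp add: w_def sum_distrib_left sum_divide_distrib mult.left_commute)
    finally show ?thesis .
  qed
  have "fractional_matching d e J w" unfolding fractional_matching_def
  proof (intro conjI ballI allI impI)
    fix \<sigma> assume "\<sigma> \<in> J"
    then show "0 \<le> w \<sigma>" using tot[OF c] by (simp add: w_def J_def)
  next
    fix k j assume k: "k < d"
    have "load e J w (k, j) = real m * F c k j"
      using sumJ[of "\<lambda>\<sigma>. if t \<sigma> ! k = j then 1 else 0"] by (simp add: load_alt[OF J(1)] e_def F_def)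
    moreover have "F c k j = 0" if "\<not> j < m"
      using that t_less[OF _ k] by (auto simp: F_def intro!: sum.neutral)
    ultimately show "load e J w (k, j) \<le> 1" using Fc[OF k, of j] by (cases "j < m") auto
  qed
  from matching_of_fractional_matching[OF J(1) \<open>2 \<le> d\<close> this] obtain M where M: "M \<subseteq> J"
    "sum w J \<le> real (d - 1) * card M" "\<And>\<sigma> \<tau> k. \<sigma> \<in> M \<Longrightarrow> \<tau> \<in> M \<Longrightarrow> \<sigma> \<noteq> \<tau> \<Longrightarrow> k < d \<Longrightarrow> t \<sigma> ! k \<noteq> t \<tau> ! k"
    unfolding e_def by (metis (no_types, lifting))
  have "sum w J = real m" using sumJ[of "\<lambda>_. 1"] tot[OF c] by (simp add: tot_def)
  then have size: "real m \<le> real (d - 1) * card M" using M(2) by simp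
  \<comment> \<open>The larger set has the larger pool of happy players and the smaller rank. Since
    the members of \<open>J\<close> form a chain, this makes \<open>P\<close> injective on
    \<open>M\<close>.\<close>
  have lt: "P \<tau> < P \<sigma>" if "\<sigma> \<subset> \<tau>" "\<sigma> \<in> Good" "\<tau> \<in> Good" for \<sigma> \<tau>
  proof (rule has_rank_less[of "B \<sigma>" "B \<tau>" "D - card \<sigma>" _ "D - card \<tau>"])
    have "card \<sigma> < card \<tau>" using that finV by (intro psubset_card_mono) (auto simp: Good_def dest: finite_subset)
    then show "D - card \<tau> < D - card \<sigma>" using that(3) by (auto simp: Good_def)
  qed (use that PWt finB in \<open>auto simp: B_def\<close>)
  have inj: "inj_on P M"
  proof (rule inj_onI, rule ccontr)
    fix \<sigma> \<tau> assume *: "\<sigma> \<in> M" "\<tau> \<in> M" "P \<sigma> = P \<tau>" "\<sigma> \<noteq> \<tau>"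
    then have G: "\<sigma> \<in> Good" "\<tau> \<in> Good" "0 < \<beta> c \<sigma>" "0 < \<beta> c \<tau>" using M(1) by (auto simp: J_def)
    then have "\<sigma> \<subseteq> V" "\<tau> \<subseteq> V" by (auto simp: Good_def)
    then have "\<sigma> \<subseteq> \<tau> \<or> \<tau> \<subseteq> \<sigma>"
      using G(3,4) unfolding \<beta>_def
      by (rule bary_weight_chain[of V "grid_weight d m N c", OF finV grid_weight_nonneg])
    then show False using lt[of \<sigma> \<tau>] lt[of \<tau> \<sigma>] G * by auto
  qed
  define alloc where "alloc i = t (the_inv_into M P i)" for i
  have alloc: "alloc (P \<sigma>) = t \<sigma>" if "\<sigma> \<in> M" for \<sigma> using that inj by (simp add: alloc_def the_inv_into_f_f)
  show ?thesis
  proof (rule exI[of _ c], rule exI[of _ "P ` M"], rule exI[of _ alloc], intro conjI ballI)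
    show "P ` M \<subseteq> {0..<n}" using M(1) J(2) PWt B_sub by (fastforce simp: has_rank_def)
    show "real m \<le> real (d - 1) * card (P ` M)" using size inj by (simp add: card_image)
  next
    fix i assume "i \<in> P ` M"
    then obtain \<sigma> where \<sigma>: "\<sigma> \<in> M" "i = P \<sigma>" by blast
    then have G: "\<sigma> \<in> Good" "0 < \<beta> c \<sigma>" "\<sigma> \<subseteq> V" using M(1) by (auto simp: J_def Good_def)
    show "dtuple d m (alloc i)" using PWt[OF G(1)] alloc \<sigma> by simp
    have W: "W \<sigma> \<in> \<sigma>" "W \<sigma> \<in> V" using PWt[OF G(1)] G(3) by auto
    have "\<bar>W \<sigma> k j - c k j\<bar> < 1 / real N" for k j
      using pos[OF G(3,2) W(1)] c pcV[OF W(2)] \<open>0 < N\<close> by (rule grid_weight_close)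
    then show "\<exists>v. partition_cuts d m v \<and> (\<forall>k j. \<bar>v k j - c k j\<bar> < 1 / real N) \<and> pref i v (alloc i)"
      using PWt[OF G(1)] alloc \<sigma> pcV[OF W(2)] by auto
  next
    fix i i' assume "i \<in> P ` M" "i' \<in> P ` M"
    then obtain \<sigma> \<tau> where "\<sigma> \<in> M" "i = P \<sigma>" "\<tau> \<in> M" "i' = P \<tau>" by blast
    then show "i \<noteq> i' \<longrightarrow> (\<forall>k<d. alloc i ! k \<noteq> alloc i' ! k)" using alloc M(3)[of \<sigma> \<tau>] by auto
  qed (use c in auto)
qed

section \<open>Passage to the limit over finer and finer grids\<close>

theorem theorem1p10:
  fixes n m d :: nat
    and pref :: "nat \<Rightarrow> (nat \<Rightarrow> nat \<Rightarrow> real) \<Rightarrow> nat list \<Rightarrow> bool"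
  assumes "0 < n" "0 < m" "0 < d"
    and "n \<ge> d * (m - 1) + 1"
    and "hungry n m d pref"
  shows "\<exists>c S alloc. partition_cuts d m c \<and> S \<subseteq> {0..<n} \<and>
           real (card S) \<ge> real m / real (d - 1) \<and>
           (\<forall>i\<in>S. dtuple d m (alloc i) \<and> pref i c (alloc i)) \<and>
           (\<forall>i\<in>S. \<forall>i'\<in>S. i \<noteq> i' \<longrightarrow> (\<forall>k<d. alloc i ! k \<noteq> alloc i' ! k))"
proof (cases "d = 1")
  case True
  \<comment> \<open>Here \<open>m / (d - 1) = m / 0 = 0\<close>, so no player has to be served.\<close>
  have "partition_cuts d m (box_cuts d m (\<lambda>_. 0))"
    using assms(2) by (intro partition_cuts_box_cuts) (auto simp: box01_def)
  then show ?thesis using True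
    by (intro exI[of _ "box_cuts d m (\<lambda>_. 0)"] exI[of _ "{}"]) auto
next
  case False
  then have d: "2 \<le> d" using assms(3) by simp
  have "\<exists>c S alloc. partition_cuts d m c \<and> S \<subseteq> {0..<n} \<and> real m \<le> real (d - 1) * card S \<and>
    (\<forall>i\<in>S. dtuple d m (alloc i) \<and>
      (\<exists>v. partition_cuts d m v \<and> (\<forall>k j. \<bar>v k j - c k j\<bar> < 1 / real (Suc l)) \<and> pref i v (alloc i))) \<and>
    (\<forall>i\<in>S. \<forall>i'\<in>S. i \<noteq> i' \<longrightarrow> (\<forall>k<d. alloc i ! k \<noteq> alloc i' ! k))" for l
    using assms(5,4,2) d by (rule approximate_allocation) simp
  then obtain c S alloc where c: "\<And>l. partition_cuts d m (c l)" and S: "\<And>l. S l \<subseteq> {0..<n}"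
    and size: "\<And>l. real m \<le> real (d - 1) * card (S l)"
    and alloc: "\<And>l i. i \<in> S l \<Longrightarrow> dtuple d m (alloc l i) \<and>
      (\<exists>v. partition_cuts d m v \<and> (\<forall>k j. \<bar>v k j - c l k j\<bar> < 1 / real (Suc l)) \<and> pref i v (alloc l i))"
    and disj: "\<And>l i i' k. i \<in> S l \<Longrightarrow> i' \<in> S l \<Longrightarrow> i \<noteq> i' \<Longrightarrow> k < d \<Longrightarrow> alloc l i ! k \<noteq> alloc l i' ! k"
    by metis
  \<comment> \<open>With the allocation reset to \<open>[]\<close> off \<open>S l\<close>, the
    players served and their tuples take only finitely many joint values, so they are constant along
    a subsequence.\<close>
  define key where "key l = (S l, \<lambda>i. if i \<in> S l then alloc l i else [])" for l
  let ?T = "insert [] {t. dtuple d m t}"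
  have "{t. dtuple d m t} = {t. set t \<subseteq> {..<m} \<and> length t = d}" by (auto simp: dtuple_def)
  then have "finite ?T" by (simp add: finite_lists_length_eq)
  then have fin: "finite {f. \<forall>i. (i \<in> {0..<n} \<longrightarrow> f i \<in> ?T) \<and> (i \<notin> {0..<n} \<longrightarrow> f i = [])}"
    by (intro finite_set_of_finite_funs) auto
  have S_less: "i < n" if "i \<in> S l" for i l using that S[of l] by auto
  have "range key \<subseteq> Pow {0..<n} \<times> {f. \<forall>i. (i \<in> {0..<n} \<longrightarrow> f i \<in> ?T) \<and> (i \<notin> {0..<n} \<longrightarrow> f i = [])}"
  proof
    fix y assume "y \<in> range key"
    then obtain l where "y = key l" by blast
    moreover have "dtuple d m (alloc l i)" "i < n" if "i \<in> S l" for i using that alloc S_less by auto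
    ultimately show "y \<in> Pow {0..<n} \<times> {f. \<forall>i. (i \<in> {0..<n} \<longrightarrow> f i \<in> ?T) \<and> (i \<notin> {0..<n} \<longrightarrow> f i = [])}"
      using S[of l] by (simp add: key_def)
  qed
  then have "finite (range key)" using fin finite_subset by blast
  then obtain l0 where "infinite {l. key l = key l0}"
    using pigeonhole_infinite[of UNIV key] by auto
  from infinite_enumerate[OF this] obtain r0 :: "nat \<Rightarrow> nat"
    where r0: "strict_mono r0" "\<And>l. key (r0 l) = key l0"
    by auto
  have key: "S (r0 l) = S l0" "\<And>i. i \<in> S l0 \<Longrightarrow> alloc (r0 l) i = alloc l0 i" for l
    using r0(2)[of l] by (auto simp: key_def fun_eq_iff split: if_splits)
  define X where "X l = (\<lambda>(k, j). c (r0 l) k j)" for l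
  have "X l \<in> box01" for l using partition_cuts_bounds[OF c] by (auto simp: X_def box01_def)
  from box01_sequence[of X, OF this] obtain x r where r: "strict_mono r" and x: "(X \<circ> r) \<longlonglongrightarrow> x" by blast
  define q where "q = r0 \<circ> r"
  define c' where "c' k j = x (k, j)" for k j
  have q: "strict_mono q" unfolding q_def using r0(1) r by (rule strict_mono_o)
  have lim: "(\<lambda>l. c (q l) k j) \<longlonglongrightarrow> c' k j" for k j
    using tendsto_coordinate[OF x, of "(k, j)"] by (simp add: X_def c'_def q_def)
  have pc': "partition_cuts d m c'" unfolding partition_cuts_def
  proof (intro conjI allI impI)
    fix k j
    show "c' k 0 = 0" "c' k m = 1" if "k < d"
      using that c LIMSEQ_unique[OF lim[of k 0]] LIMSEQ_unique[OF lim[of k m]]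
      by (auto simp: partition_cuts_def)
    show "c' k j \<le> c' k (Suc j)" if "k < d" "j < m"
      using that c by (intro LIMSEQ_le[OF lim lim]) (auto simp: partition_cuts_def)
    show "c' k j = 0" if "d \<le> k \<or> m < j"
      using that c LIMSEQ_unique[OF lim[of k j]] by (auto simp: partition_cuts_def)
  qed
  \<comment> \<open>The partitions \<open>v l\<close> at which player \<open>i\<close> prefers the
    now fixed tuple converge to \<open>c'\<close> as well, because the meshes tend to 0; closedness
    of preferences applies.\<close>
  have pref: "pref i c' (alloc l0 i)" if i: "i \<in> S l0" for i
  proof -
    have "\<exists>v. partition_cuts d m v \<and> (\<forall>k j. \<bar>v k j - c (q l) k j\<bar> < 1 / real (Suc (q l))) \<and>
        pref i v (alloc l0 i)" for l
      using alloc[of i "q l"] i key(1)[of "r l"] key(2)[OF i, of "r l"] by (simp add: q_def)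
    then obtain v where v: "\<And>l. partition_cuts d m (v l)" "\<And>l. pref i (v l) (alloc l0 i)"
      "\<And>l k j. \<bar>v l k j - c (q l) k j\<bar> < 1 / real (Suc (q l))" by metis
    have "(\<lambda>l. 1 / real (Suc l)) \<longlonglongrightarrow> 0" using LIMSEQ_inverse_real_of_nat by (simp add: inverse_eq_divide)
    from LIMSEQ_subseq_LIMSEQ[OF this q] have lim0: "(\<lambda>l. 1 / real (Suc (q l))) \<longlonglongrightarrow> 0" by (simp add: o_def)
    have "(\<lambda>l. v l k j) \<longlonglongrightarrow> c' k j" for k j
    proof -
      have "(\<lambda>l. v l k j - c (q l) k j) \<longlonglongrightarrow> 0"
        using v(3) by (intro Lim_null_comparison[OF _ lim0] always_eventually) (auto intro: less_imp_le)
      from tendsto_add[OF this lim[of k j]] show ?thesis by simp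
    qed
    moreover have "i < n" using S_less[OF i] .
    moreover have "dtuple d m (alloc l0 i)" using alloc[OF i] by simp
    ultimately show ?thesis using assms(5) v(1,2) pc' unfolding hungry_def by blast
  qed
  have "real m / real (d - 1) \<le> real (card (S l0))"
    using size[of l0] d by (simp add: divide_le_eq mult.commute)
  then show ?thesis using pc' S[of l0] alloc pref disj[of _ l0]
    by (intro exI[of _ c'] exI[of _ "S l0"] exI[of _ "alloc l0"]) auto
qed

end
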